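(* Consider the Distributed Block Proximal Method described in the context, with positive diminishing local stepsizes: for every $i\in\{1,\dots,N\}$, $\sum_{t=0}^\infty\alpha_i^t=\infty$, $\sum_{t=0}^\infty(\alpha_i^t)^2<\infty$, and $\alpha_i^{t+1}\le\alpha_i^t$ for all $t$. Assume there are $G_i,\bar G_i\in[0,\infty)$ with $\mathbb{E}[\|g_i(x;\xi_i)\|]\le G_i$ and $\mathbb{E}[\|g_i(x;\xi_i)\|^2]\le\bar G_i$ for all $x$ and $i$, and constants $C_i\in[0,\infty)$ with $\mathbb{E}[\|x_i^0\|]\le C_i$ for all $i$. Then, for all $i\in\{1,\dots,N\}$, $$\lim_{t\to\infty}\mathbb{E}[\|x_i^t-\bar x^t\|]=0.$$
   Context: Problem: minimize $\sum_{i=1}^Nf_i(x)$ over $x\in X\subseteq\mathbb{R}^n$, where $f_i(x)=\mathbb{E}[h_i(x;\xi_i)]$, $\xi_i$ is a random variable, and $h_i(\cdot;\xi_i):\mathbb{R}^n\to\mathbb{R}$ is continuous and convex (possibly nonsmooth) for every $\xi_i$. Block structure: $x=[x_1^\top,\dots,x_B^\top]^\top$ with $x_\ell\in\mathbb{R}^{n_\ell}$, $\sum_\ell n_\ell=n$, and $X=X_1\times\dots\times X_B$ with each $X_\ell\subseteq\mathbb{R}^{n_\ell}$ closed and convex. $\|\cdot\|$ is the 2-norm; $x_{i,\ell}$ (resp. $g_{i,\ell}$) is the $\ell$-th block of $x_i$ (resp. of $g_i$). Network: a strongly connected directed graph on $\{1,\dots,N\}$ with edge set $\mathcal{E}$ and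 weight matrix $W=(w_{ij})\in\mathbb{R}^{N\times N}$ with nonnegative entries; for $i\ne j$, $w_{ij}>0$ iff $(j,i)\in\mathcal{E}$; there is $\eta>0$ with $w_{ii}\ge\eta$ and $w_{ij}\ge\eta$ whenever $w_{ij}>0$; $W$ is doubly stochastic. Proximal mapping: $\omega_\ell:X_\ell\to\mathbb{R}$ is continuously differentiable and $\sigma_\ell$-strongly convex ($\sigma_\ell>0$); $\nu_\ell(a,b)=\omega_\ell(b)-\omega_\ell(a)-\langle\nabla\omega_\ell(a),b-a\rangle$ for $a,b\in X_\ell$; $\mathrm{prox}_\ell(a,b,c)=\arg\min_{u\in X_\ell}\{\langle b,u\rangle+\frac1c\nu_\ell(a,u)\}$ for $a\in X_\ell$, $b\in\mathbb{R}^{n_\ell}$, $c>0$. Distributed Block Proximal Method: each agent $i$ starts from a random, bounded $x_i^0\in X$. For $t=0,1,\dots$ put $y_i^t=\sum_{j=1}^Nw_{ij}x_j^t$. If $s_i^t=1$ (awake): $x_{i,\ell}^{t+1}=\mathrm{prox}_\ell(y_{i,\ell}^t,g_{i,\ell}(y_i^t;\xi_i^t),\alpha_i^t)$ for $\ell=\ell_i^t$ and $x_{i,\ell}^{t+1}=x_{i,\ell}^t$ for $\ell\ne\ell_i^t$. If $s_i^t=0$ (idle): $x_i^{t+1}=x_i^t$. Here $g_i(x;\xi)\in\partial h_i(x;\xi)$ is a (whole) subgradient and $\alpha_i^t>0$ are local stepsizes. Random variables: $s_i^t\in\{0,1\}$ with $P(s_i^t=1)=p_{i,on}\in(0,1]$;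 $\ell_i^t\in\{1,\dots,B\}$ with $P(\ell_i^t=\ell)=p_{i,\ell}>0$; $\xi_i^t$ is distributed as $\xi_i$. For each $i$, the variables $\ell_i^t$ and $s_i^t$ are i.i.d. over $t$; for each $t$, the variables $s_i^t,\ell_i^t,\xi_i^t$ ($i=1,\dots,N$) are independent of each other; the variables drawn at iteration $t$ are independent of the initial conditions and of those drawn at previous iterations. Notation: $\bar x^t=\frac1N\sum_{i=1}^Nx_i^t$. *)

theory Defs
  imports "HOL-Probability.Probability" "Graph_Theory.Digraph_Component"
begin

text \<open>
  The block structure of \<open>\<real>\<^sup>n\<close> is given by a map \<open>blk\<close> that sends each coordinate
  to its block. As the dimension varies with the block, vectors of block \<open>l\<close> are
  represented, isometrically, as the vectors of \<open>real ^ 'n\<close> supported on the coordinates of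
  block \<open>l\<close>.
\<close>

definition block_space :: "('n::finite \<Rightarrow> 'b) \<Rightarrow> 'b \<Rightarrow> (real ^ 'n) set" where
  "block_space blk l = {v. \<forall>k. blk k \<noteq> l \<longrightarrow> v $ k = 0}"

definition block :: "('n::finite \<Rightarrow> 'b) \<Rightarrow> 'b \<Rightarrow> real ^ 'n \<Rightarrow> real ^ 'n" where
  "block blk l x = (\<chi> k. if blk k = l then x $ k else 0)"

definition block_product :: "('n::finite \<Rightarrow> 'b) \<Rightarrow> ('b \<Rightarrow> (real ^ 'n) set) \<Rightarrow> (real ^ 'n) set" where
  "block_product blk X = {x. \<forall>l. block blk l x \<in> X l}"

definition subdifferential :: "('a::real_inner \<Rightarrow> real) \<Rightarrow> 'a \<Rightarrow> 'a set" where
  "subdifferential f x = {v. \<forall>y. f y \<ge> f x + v \<bullet> (y - x)}"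

definition strongly_convex_on :: "real \<Rightarrow> 'a::real_normed_vector set \<Rightarrow> ('a \<Rightarrow> real) \<Rightarrow> bool" where
  "strongly_convex_on \<sigma> S f \<longleftrightarrow> convex S \<and>
     (\<forall>a\<in>S. \<forall>b\<in>S. \<forall>\<theta>\<in>{0..1}.
        f (\<theta> *\<^sub>R a + (1 - \<theta>) *\<^sub>R b)
          \<le> \<theta> * f a + (1 - \<theta>) * f b - \<sigma> / 2 * \<theta> * (1 - \<theta>) * (norm (a - b))\<^sup>2)"

text \<open>
  \<open>d\<omega>\<close> is a gradient of \<open>\<omega>\<close> relative to \<open>S\<close>. If \<open>S\<close> has empty interior there can be several,
  but on a convex set they agree in all directions \<open>b - a\<close> with \<open>a, b \<in> S\<close>.
\<close>

definition C1_on :: "'a::real_inner set \<Rightarrow> ('a \<Rightarrow> real) \<Rightarrow> ('a \<Rightarrow> 'a) \<Rightarrow> bool" where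
  "C1_on S \<omega> d\<omega> \<longleftrightarrow>
     (\<forall>a\<in>S. (\<omega> has_derivative (\<lambda>v. d\<omega> a \<bullet> v)) (at a within S)) \<and> continuous_on S d\<omega>"

definition bregman :: "('a::real_inner \<Rightarrow> real) \<Rightarrow> ('a \<Rightarrow> 'a) \<Rightarrow> 'a \<Rightarrow> 'a \<Rightarrow> real" where
  "bregman \<omega> d\<omega> a b = \<omega> b - \<omega> a - d\<omega> a \<bullet> (b - a)"

definition prox ::
  "'a::real_inner set \<Rightarrow> ('a \<Rightarrow> real) \<Rightarrow> ('a \<Rightarrow> 'a) \<Rightarrow> 'a \<Rightarrow> 'a \<Rightarrow> real \<Rightarrow> 'a" where
  "prox S \<omega> d\<omega> a b c = arg_min_on (\<lambda>u. b \<bullet> u + 1 / c * bregman \<omega> d\<omega> a u) S"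

definition doubly_stochastic :: "real ^ 'i ^ 'i::finite \<Rightarrow> bool" where
  "doubly_stochastic W \<longleftrightarrow> (\<forall>i j. W $ i $ j \<ge> 0) \<and>
     (\<forall>i. (\<Sum>j\<in>UNIV. W $ i $ j) = 1) \<and> (\<forall>j. (\<Sum>i\<in>UNIV. W $ i $ j) = 1)"

definition graph_on :: "('i \<times> 'i) set \<Rightarrow> ('i, 'i \<times> 'i) pre_digraph" where
  "graph_on E = \<lparr>verts = UNIV, arcs = E, tail = fst, head = snd\<rparr>"

text \<open>
  The library's \<open>indep_vars\<close> and \<open>indep_var\<close> need random variables with values in one common
  type, so independence is expressed through the generated sigma-algebras.
\<close>

definition generated_events :: "'w measure \<Rightarrow> 'a measure \<Rightarrow> ('w \<Rightarrow> 'a) \<Rightarrow> 'w set set" where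
  "generated_events M N Y = sets (vimage_algebra (space M) Y N)"

datatype 'i draw = Awake 'i | Block 'i | Sample 'i

definition draw_events ::
  "'w measure \<Rightarrow> ('i \<Rightarrow> 'z measure) \<Rightarrow> ('i \<Rightarrow> nat \<Rightarrow> 'w \<Rightarrow> bool) \<Rightarrow> ('i \<Rightarrow> nat \<Rightarrow> 'w \<Rightarrow> 'b) \<Rightarrow>
   ('i \<Rightarrow> nat \<Rightarrow> 'w \<Rightarrow> 'z) \<Rightarrow> nat \<Rightarrow> 'i draw \<Rightarrow> 'w set set" where
  "draw_events M D s l \<xi> t d = (case d of
       Awake i \<Rightarrow> generated_events M (count_space UNIV) (s i t)
     | Block i \<Rightarrow> generated_events M (count_space UNIV) (l i t)
     | Sample i \<Rightarrow> generated_events M (D i) (\<xi> i t))"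

definition iteration_space :: "('i \<Rightarrow> 'z measure) \<Rightarrow> ('i \<Rightarrow> bool \<times> 'b \<times> 'z) measure" where
  "iteration_space D =
     (\<Pi>\<^sub>M i\<in>UNIV. count_space UNIV \<Otimes>\<^sub>M count_space UNIV \<Otimes>\<^sub>M D i)"

definition iteration_draws ::
  "('i \<Rightarrow> nat \<Rightarrow> 'w \<Rightarrow> bool) \<Rightarrow> ('i \<Rightarrow> nat \<Rightarrow> 'w \<Rightarrow> 'b) \<Rightarrow> ('i \<Rightarrow> nat \<Rightarrow> 'w \<Rightarrow> 'z) \<Rightarrow>
   nat \<Rightarrow> 'w \<Rightarrow> 'i \<Rightarrow> bool \<times> 'b \<times> 'z" where
  "iteration_draws s l \<xi> t w = (\<lambda>i. (s i t w, l i t w, \<xi> i t w))"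

definition history_space ::
  "('i \<Rightarrow> 'z measure) \<Rightarrow> nat \<Rightarrow>
   (('i \<Rightarrow> real ^ 'n::finite) \<times> (nat \<Rightarrow> 'i \<Rightarrow> bool \<times> 'b \<times> 'z)) measure" where
  "history_space D t = (\<Pi>\<^sub>M i\<in>UNIV. borel) \<Otimes>\<^sub>M (\<Pi>\<^sub>M \<tau>\<in>{..<t}. iteration_space D)"

definition history ::
  "('i \<Rightarrow> 'w \<Rightarrow> real ^ 'n::finite) \<Rightarrow> ('i \<Rightarrow> nat \<Rightarrow> 'w \<Rightarrow> bool) \<Rightarrow> ('i \<Rightarrow> nat \<Rightarrow> 'w \<Rightarrow> 'b) \<Rightarrow>
   ('i \<Rightarrow> nat \<Rightarrow> 'w \<Rightarrow> 'z) \<Rightarrow> nat \<Rightarrow> 'w \<Rightarrow>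
   ('i \<Rightarrow> real ^ 'n) \<times> (nat \<Rightarrow> 'i \<Rightarrow> bool \<times> 'b \<times> 'z)" where
  "history x0 s l \<xi> t w =
     ((\<lambda>i. x0 i w), (\<lambda>\<tau>\<in>{..<t}. iteration_draws s l \<xi> \<tau> w))"

end

theory Submission
  imports Defs
begin

text \<open>
  Fix a block \<open>b\<close>. In one iteration block \<open>b\<close> of agent \<open>i\<close> is replaced, with probability
  \<open>q i b\<close>, by the mixture prescribed by row \<open>i\<close> of \<open>W\<close>, and the proximal step perturbs the result by at
  most \<open>\<alpha> / \<sigma>\<close> times the norm of the subgradient. The weighted variance of the agents' blocks
  around their weighted mean, with weights \<open>1 / q i b\<close>, decreases in expectation by at least the
  amount that \<open>W\<close> takes from the sum of squares, since the weights cancel the update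
  probabilities. For a doubly stochastic \<open>W\<close> with positive diagonal on a strongly connected graph
  this amount is at least a fixed fraction of the variance. Hence the expected variance satisfies
  \<open>v (t + 1) \<le> \<rho> v t + \<delta> t\<close> with \<open>\<rho> < 1\<close> and a summable \<open>\<delta>\<close>, so it tends to 0.
  The variance lives in the second moments, which are finite because \<open>x 0\<close> is bounded and the
  subgradients have bounded second moments.
\<close>

section \<open>Proximal steps\<close>

text \<open>Convexity keeps the segment from \<open>a\<close> to \<open>u\<close> inside
  \<open>S\<close>, so the chain rule applies along it although \<open>f\<close> is differentiable
  only relative to \<open>S\<close>.\<close>

lemma has_derivative_within_directional:
  fixes f :: "'a::real_inner \<Rightarrow> real"
  assumes "convex S" "a \<in> S" "u \<in> S"
    and "(f has_derivative (\<lambda>v. d \<bullet> v)) (at a within S)"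
  shows "((\<lambda>\<theta>. (f (a + \<theta> *\<^sub>R (u - a)) - f a) / \<theta>) \<longlongrightarrow> d \<bullet> (u - a)) (at_right 0)"
proof -
  let ?p = "\<lambda>\<theta>::real. a + \<theta> *\<^sub>R (u - a)"
  have sub: "?p ` {0..1} \<subseteq> S"
  proof clarify
    fix \<theta> :: real assume "\<theta> \<in> {0..1}"
    then have "(1 - \<theta>) *\<^sub>R a + \<theta> *\<^sub>R u \<in> S"
      using assms(1-3) by (intro convexD) auto
    then show "?p \<theta> \<in> S" by (simp add: algebra_simps)
  qed
  have p: "(?p has_derivative (\<lambda>h. h *\<^sub>R (u - a))) (at 0 within {0..1})"
    by (auto intro!: derivative_eq_intros)
  have "((\<lambda>\<theta>. f (?p \<theta>)) has_derivative (\<lambda>h. d \<bullet> (h *\<^sub>R (u - a)))) (at 0 within {0..1})"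
    by (rule has_derivative_in_compose[OF p])
       (use has_derivative_subset[OF assms(4) sub] in simp)
  then have "((\<lambda>\<theta>. f (?p \<theta>)) has_real_derivative d \<bullet> (u - a)) (at 0 within {0..1})"
    by (simp add: has_field_derivative_def mult_commute_abs)
  then have "((\<lambda>\<theta>. (f (?p \<theta>) - f a) / \<theta>) \<longlongrightarrow> d \<bullet> (u - a)) (at 0 within {0..1})"
    by (simp add: has_field_derivative_iff)
  then show ?thesis by (simp add: at_within_Icc_at_right)
qed

text \<open>Strong convexity on the segment bounds the difference quotient \<open>?q\<close> by
  \<open>?r\<close>. As \<theta> decreases to 0, the quotient becomes the directional derivative and
  the factor \<open>1 - \<theta>\<close> disappears.\<close>

lemma bregman_ge_quadratic:
  assumes "C1_on S \<omega> d\<omega>" "strongly_convex_on \<sigma> S \<omega>" "a \<in> S" "u \<in> S"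
  shows "bregman \<omega> d\<omega> a u \<ge> \<sigma> / 2 * (norm (u - a))\<^sup>2"
proof -
  let ?q = "\<lambda>\<theta>. (\<omega> (a + \<theta> *\<^sub>R (u - a)) - \<omega> a) / \<theta>"
  let ?r = "\<lambda>\<theta>. \<omega> u - \<omega> a - \<sigma> / 2 * (1 - \<theta>) * (norm (u - a))\<^sup>2"
  have cv: "convex S" using assms(2) by (simp add: strongly_convex_on_def)
  have "(?q \<longlongrightarrow> d\<omega> a \<bullet> (u - a)) (at_right 0)"
    using assms by (intro has_derivative_within_directional[OF cv]) (auto simp: C1_on_def)
  moreover have "(?r \<longlongrightarrow> \<omega> u - \<omega> a - \<sigma> / 2 * (1 - 0) * (norm (u - a))\<^sup>2) (at_right 0)"
    by (intro tendsto_intros)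
  moreover have "\<forall>\<^sub>F \<theta> in at_right 0. ?q \<theta> \<le> ?r \<theta>"
    unfolding eventually_at_right_field
  proof (intro exI[of _ 1] conjI allI impI)
    fix \<theta> :: real assume t: "0 < \<theta>" "\<theta> < 1"
    have "\<omega> (\<theta> *\<^sub>R u + (1 - \<theta>) *\<^sub>R a) \<le> \<theta> * \<omega> u + (1 - \<theta>) * \<omega> a - \<sigma> / 2 * \<theta> * (1 - \<theta>) * (norm (u - a))\<^sup>2"
      using assms(2-4) t unfolding strongly_convex_on_def by auto
    moreover have "\<theta> *\<^sub>R u + (1 - \<theta>) *\<^sub>R a = a + \<theta> *\<^sub>R (u - a)" by (simp add: algebra_simps)
    ultimately have "\<omega> (a + \<theta> *\<^sub>R (u - a)) - \<omega> a \<le> \<theta> * ?r \<theta>"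
      by (simp add: algebra_simps)
    then show "?q \<theta> \<le> ?r \<theta>" using t by (simp add: divide_le_eq mult.commute)
  qed simp
  ultimately have "d\<omega> a \<bullet> (u - a) \<le> \<omega> u - \<omega> a - \<sigma> / 2 * (1 - 0) * (norm (u - a))\<^sup>2"
    by (intro tendsto_le[OF _ _ \<open>(?q \<longlongrightarrow> _) _\<close>]) simp_all
  then show ?thesis by (simp add: bregman_def)
qed

lemma strongly_convex_on_add_inner:
  assumes "strongly_convex_on \<sigma> S \<omega>"
  shows "strongly_convex_on \<sigma> S (\<lambda>u. \<omega> u + v \<bullet> u)"
  using assms unfolding strongly_convex_on_def by (simp add: inner_add_right algebra_simps)

text \<open>A point of the segment from \<open>m\<close> to \<open>u\<close> has at least the value
  at \<open>m\<close>. Dividing the strong convexity inequality by \<theta> and letting \<theta>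
  tend to 0 leaves the full constant \<open>\<sigma> / 2\<close>.\<close>

lemma strongly_convex_on_minimizer_growth:
  assumes "strongly_convex_on \<sigma> S f" "m \<in> S" "\<And>u. u \<in> S \<Longrightarrow> f m \<le> f u" "u \<in> S"
  shows "f m + \<sigma> / 2 * (norm (u - m))\<^sup>2 \<le> f u"
proof -
  let ?r = "\<lambda>\<theta>. f m + \<sigma> / 2 * (1 - \<theta>) * (norm (u - m))\<^sup>2"
  have "(?r \<longlongrightarrow> f m + \<sigma> / 2 * (1 - 0) * (norm (u - m))\<^sup>2) (at_right 0)"
    by (intro tendsto_intros)
  moreover have "\<forall>\<^sub>F \<theta> in at_right 0. ?r \<theta> \<le> f u"
    unfolding eventually_at_right_field
  proof (intro exI[of _ 1] conjI allI impI)
    fix \<theta> :: real assume t: "0 < \<theta>" "\<theta> < 1"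
    have "f (\<theta> *\<^sub>R u + (1 - \<theta>) *\<^sub>R m) \<le> \<theta> * f u + (1 - \<theta>) * f m - \<sigma> / 2 * \<theta> * (1 - \<theta>) * (norm (u - m))\<^sup>2"
      using assms t unfolding strongly_convex_on_def by auto
    moreover have "\<theta> *\<^sub>R u + (1 - \<theta>) *\<^sub>R m \<in> S"
      using assms t by (intro convexD) (auto simp: strongly_convex_on_def)
    ultimately have "f m \<le> \<theta> * f u + (1 - \<theta>) * f m - \<sigma> / 2 * \<theta> * (1 - \<theta>) * (norm (u - m))\<^sup>2"
      using assms(3) by force
    then have "\<theta> * ?r \<theta> \<le> \<theta> * f u"
      by (simp add: algebra_simps)
    then show "?r \<theta> \<le> f u" using t by simp
  qed simp
  ultimately show ?thesis
    using tendsto_upperbound[of ?r _ "at_right 0" "f u"] by simp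
qed

text \<open>As \<open>S\<close> may be unbounded, quadratic growth is used first: outside a large
  ball around any \<open>a\<close> in \<open>S\<close> the tilted function is at least its value at
  \<open>a\<close>. On the compact rest a minimum is attained.\<close>

lemma strongly_convex_minimizer_exists:
  fixes S :: "'a::euclidean_space set"
  assumes S: "closed S" "S \<noteq> {}" and C1: "C1_on S \<omega> d\<omega>" and sc: "strongly_convex_on \<sigma> S \<omega>"
    and "\<sigma> > 0"
  shows "\<exists>m\<in>S. \<forall>u\<in>S. \<omega> m + v \<bullet> m \<le> \<omega> u + v \<bullet> u"
proof -
  obtain a where a: "a \<in> S" using S by auto
  \<comment> \<open>Beyond this radius the quadratic term
    \<open>\<sigma> / 2 * (norm (u - a))\<^sup>2\<close> outweighs the largest possible linear loss
    \<open>norm (d\<omega> a + v) * norm (u - a)\<close>.\<close>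
  define r where "r = 2 * norm (d\<omega> a + v) / \<sigma>"
  have r: "r \<ge> 0" using \<open>\<sigma> > 0\<close> by (simp add: r_def)
  have "continuous_on S \<omega>"
    using C1 unfolding C1_on_def by (meson continuous_on_eq_continuous_within has_derivative_continuous)
  then have "continuous_on (S \<inter> cball a r) (\<lambda>u. \<omega> u + v \<bullet> u)"
    by (intro continuous_intros) (auto intro: continuous_on_subset)
  moreover have "compact (S \<inter> cball a r)" "S \<inter> cball a r \<noteq> {}"
    using S a r by (auto simp: closed_Int_compact)
  ultimately obtain m where m: "m \<in> S \<inter> cball a r"
      "\<forall>u\<in>S \<inter> cball a r. \<omega> m + v \<bullet> m \<le> \<omega> u + v \<bullet> u"
    using continuous_attains_inf[of "S \<inter> cball a r" "\<lambda>u. \<omega> u + v \<bullet> u"] by blast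
  show ?thesis
  proof (intro bexI[of _ m] ballI)
    fix u assume u: "u \<in> S"
    show "\<omega> m + v \<bullet> m \<le> \<omega> u + v \<bullet> u"
    proof (cases "u \<in> cball a r")
      case False
      then have d: "norm (u - a) > r" by (simp add: dist_norm norm_minus_commute)
      have "\<omega> u \<ge> \<omega> a + d\<omega> a \<bullet> (u - a) + \<sigma> / 2 * (norm (u - a))\<^sup>2"
        using bregman_ge_quadratic[OF C1 sc a u] by (simp add: bregman_def)
      moreover have "(d\<omega> a + v) \<bullet> (u - a) \<ge> - (norm (d\<omega> a + v) * norm (u - a))"
        using Cauchy_Schwarz_ineq2[of "d\<omega> a + v" "u - a"] by linarith
      moreover have "norm (d\<omega> a + v) * norm (u - a) \<le> \<sigma> / 2 * norm (u - a) * norm (u - a)"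
        using d \<open>\<sigma> > 0\<close> by (intro mult_right_mono) (auto simp: r_def field_simps)
      ultimately have "\<omega> a + v \<bullet> a \<le> \<omega> u + v \<bullet> u"
        by (simp add: power2_eq_square inner_add_left inner_diff_right)
      moreover have "\<omega> m + v \<bullet> m \<le> \<omega> a + v \<bullet> a" using m a r by auto
      ultimately show ?thesis by simp
    qed (use m u in auto)
  qed (use m in auto)
qed

section \<open>Proximal points as minimizers under a linear tilt\<close>

text \<open>For a strongly convex \<omega>, extended by infinity outside \<open>S\<close>, this is
  the gradient of the convex conjugate at \<open>- v\<close>. It turns the proximal map into a
  function of a single vector, whose continuity gives measurability.\<close>

definition tilted_min :: "'a::real_inner set \<Rightarrow> ('a \<Rightarrow> real) \<Rightarrow> 'a \<Rightarrow> 'a" where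
  "tilted_min S \<omega> v = arg_min_on (\<lambda>u. \<omega> u + v \<bullet> u) S"

lemma prox_eq_tilted_min:
  assumes "c > 0"
  shows "prox S \<omega> d\<omega> a b c = tilted_min S \<omega> (c *\<^sub>R b - d\<omega> a)"
proof -
  have "b \<bullet> u + 1 / c * bregman \<omega> d\<omega> a u
      = (1 / c) * (\<omega> u + (c *\<^sub>R b - d\<omega> a) \<bullet> u) + (1 / c) * (d\<omega> a \<bullet> a - \<omega> a)" for u
    using assms by (simp add: bregman_def field_simps inner_diff_right inner_diff_left)
  \<comment> \<open>Scaling by \<open>1 / c\<close> and adding a term free of \<open>u\<close>
    preserves minimizers. Since \<open>arg_min\<close> is a choice from this predicate, equal
    predicates select the same point.\<close>
  then have "is_arg_min (\<lambda>u. b \<bullet> u + 1 / c * bregman \<omega> d\<omega> a u) (\<lambda>u. u \<in> S)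
      = is_arg_min (\<lambda>u. \<omega> u + (c *\<^sub>R b - d\<omega> a) \<bullet> u) (\<lambda>u. u \<in> S)"
    using assms by (intro ext) (simp add: is_arg_min_def divide_less_cancel)
  then show ?thesis by (simp add: prox_def tilted_min_def arg_min_on_def arg_min_def)
qed

locale mirror_map =
  fixes S :: "'a::euclidean_space set" and \<omega> d\<omega> \<sigma>
  assumes closed_S: "closed S" and nonempty_S: "S \<noteq> {}" and C1: "C1_on S \<omega> d\<omega>"
    and strongly_convex: "strongly_convex_on \<sigma> S \<omega>" and sigma_pos: "\<sigma> > 0"
begin

lemma tilted_min_props:
  shows tilted_min_in: "tilted_min S \<omega> v \<in> S"
    and tilted_min_le: "u \<in> S \<Longrightarrow> \<omega> (tilted_min S \<omega> v) + v \<bullet> tilted_min S \<omega> v \<le> \<omega> u + v \<bullet> u"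
proof -
  obtain m where "is_arg_min (\<lambda>u. \<omega> u + v \<bullet> u) (\<lambda>u. u \<in> S) m"
    using strongly_convex_minimizer_exists[OF closed_S nonempty_S C1 strongly_convex sigma_pos, of v]
    by (auto simp: is_arg_min_linorder)
  then have "is_arg_min (\<lambda>u. \<omega> u + v \<bullet> u) (\<lambda>u. u \<in> S) (tilted_min S \<omega> v)"
    unfolding tilted_min_def arg_min_on_def arg_min_def by (rule someI)
  then show "tilted_min S \<omega> v \<in> S"
    and "u \<in> S \<Longrightarrow> \<omega> (tilted_min S \<omega> v) + v \<bullet> tilted_min S \<omega> v \<le> \<omega> u + v \<bullet> u"
    by (auto simp: is_arg_min_linorder)
qed

text \<open>Adding the quadratic growth inequalities at the two minimizers cancels \<omega>;
  Cauchy-Schwarz and division by the distance do the rest. Arbitrary minimizers are allowed so that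
  a proximal point can be compared with a point recognized as a minimizer for another tilt.\<close>

lemma minimizers_lipschitz:
  assumes m1: "m1 \<in> S" "\<And>u. u \<in> S \<Longrightarrow> \<omega> m1 + v1 \<bullet> m1 \<le> \<omega> u + v1 \<bullet> u"
    and m2: "m2 \<in> S" "\<And>u. u \<in> S \<Longrightarrow> \<omega> m2 + v2 \<bullet> m2 \<le> \<omega> u + v2 \<bullet> u"
  shows "norm (m1 - m2) \<le> norm (v1 - v2) / \<sigma>"
proof -
  have "\<omega> m1 + v1 \<bullet> m1 + \<sigma> / 2 * (norm (m2 - m1))\<^sup>2 \<le> \<omega> m2 + v1 \<bullet> m2"
    by (rule strongly_convex_on_minimizer_growth[OF strongly_convex_on_add_inner[OF strongly_convex]])
       (use m1 m2 in auto)
  moreover have "\<omega> m2 + v2 \<bullet> m2 + \<sigma> / 2 * (norm (m1 - m2))\<^sup>2 \<le> \<omega> m1 + v2 \<bullet> m1"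
    by (rule strongly_convex_on_minimizer_growth[OF strongly_convex_on_add_inner[OF strongly_convex]])
       (use m1 m2 in auto)
  ultimately have "\<sigma> * (norm (m1 - m2))\<^sup>2 \<le> (v1 - v2) \<bullet> (m2 - m1)"
    by (simp add: norm_minus_commute inner_diff_left inner_diff_right)
  also have "\<dots> \<le> norm (v1 - v2) * norm (m1 - m2)"
    by (metis norm_cauchy_schwarz norm_minus_commute)
  finally have *: "norm (m1 - m2) * (\<sigma> * norm (m1 - m2)) \<le> norm (m1 - m2) * norm (v1 - v2)"
    by (simp add: power2_eq_square mult_ac)
  show ?thesis
  proof (cases "norm (m1 - m2) = 0")
    case False
    then have "\<sigma> * norm (m1 - m2) \<le> norm (v1 - v2)"
      using * by (simp only: mult_le_cancel_left) auto
    then show ?thesis using sigma_pos by (simp add: field_simps)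
  next
    case True
    then show ?thesis using sigma_pos by (simp only:) simp
  qed
qed

lemma continuous_tilted_min: "continuous_on UNIV (tilted_min S \<omega>)"
proof -
  have "(1 / \<sigma>)-lipschitz_on UNIV (tilted_min S \<omega>)"
  proof (rule lipschitz_onI)
    fix v1 v2 :: 'a
    show "dist (tilted_min S \<omega> v1) (tilted_min S \<omega> v2) \<le> 1 / \<sigma> * dist v1 v2"
      using minimizers_lipschitz[OF tilted_min_in tilted_min_le tilted_min_in tilted_min_le, of v1 v2]
      by (simp add: dist_norm)
  qed (use sigma_pos in simp)
  then show ?thesis by (rule lipschitz_on_continuous_on)
qed

lemma prox_in: "c > 0 \<Longrightarrow> prox S \<omega> d\<omega> a b c \<in> S"
  by (simp add: prox_eq_tilted_min tilted_min_in)

text \<open>The point \<open>a\<close> is itself the proximal point for the zero direction.\<close>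

lemma prox_dist_le:
  assumes "c > 0" "a \<in> S"
  shows "norm (prox S \<omega> d\<omega> a b c - a) \<le> c / \<sigma> * norm b"
proof -
  have "\<omega> a + (- d\<omega> a) \<bullet> a \<le> \<omega> u + (- d\<omega> a) \<bullet> u" if "u \<in> S" for u
  proof -
    have "0 \<le> \<sigma> / 2 * (norm (u - a))\<^sup>2" using sigma_pos by simp
    also have "\<dots> \<le> bregman \<omega> d\<omega> a u"
      by (rule bregman_ge_quadratic[OF C1 strongly_convex assms(2) that])
    finally show ?thesis by (simp add: bregman_def inner_diff_right)
  qed
  from minimizers_lipschitz[OF tilted_min_in tilted_min_le assms(2) this, of "c *\<^sub>R b - d\<omega> a"]
  show ?thesis using assms(1) by (simp add: prox_eq_tilted_min)
qed

lemma borel_measurable_prox: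
  assumes "c > 0" and "a \<in> borel_measurable N" "b \<in> borel_measurable N"
    and "\<And>w. w \<in> space N \<Longrightarrow> a w \<in> S"
  shows "(\<lambda>w. prox S \<omega> d\<omega> (a w) (b w) c) \<in> borel_measurable N"
proof -
  \<comment> \<open>The gradient is continuous only on \<open>S\<close>. Its extension by 0 off this
    closed set is Borel and agrees with it at all values of \<open>a\<close>.\<close>
  have "(\<lambda>v. indicator S v *\<^sub>R d\<omega> v) \<in> borel_measurable borel"
    using closed_S C1 by (intro borel_measurable_continuous_on_indicator) (auto simp: C1_on_def)
  moreover have "tilted_min S \<omega> \<in> borel_measurable borel"
    by (intro borel_measurable_continuous_onI continuous_tilted_min)
  ultimately have "(\<lambda>w. tilted_min S \<omega> (c *\<^sub>R b w - indicator S (a w) *\<^sub>R d\<omega> (a w))) \<in> borel_measurable N"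
    using assms(2,3) by measurable
  then show ?thesis
    by (rule measurable_cong[THEN iffD1, rotated]) (use assms in \<open>simp add: prox_eq_tilted_min\<close>)
qed

end

section \<open>Mixing over the network\<close>

text \<open>For nonnegative weights this is the variance written as half the mean squared distance
  of two independent draws. It follows by expanding the squared distances.\<close>

lemma weighted_norm_square_sum_diff:
  fixes u :: "'i::finite \<Rightarrow> 'a::real_inner" and p :: "'i \<Rightarrow> real"
  assumes "(\<Sum>j\<in>UNIV. p j) = 1"
  shows "(\<Sum>j\<in>UNIV. p j * (norm (u j))\<^sup>2) - (norm (\<Sum>j\<in>UNIV. p j *\<^sub>R u j))\<^sup>2
    = (\<Sum>j\<in>UNIV. \<Sum>k\<in>UNIV. p j * p k * (norm (u j - u k))\<^sup>2) / 2"
proof -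
  let ?s = "\<Sum>j\<in>UNIV. p j * (norm (u j))\<^sup>2"
  have "(\<Sum>j\<in>UNIV. \<Sum>k\<in>UNIV. p j * p k * (norm (u j - u k))\<^sup>2)
      = (\<Sum>j\<in>UNIV. \<Sum>k\<in>UNIV. p k * (p j * (norm (u j))\<^sup>2) + p j * (p k * (norm (u k))\<^sup>2)
          - 2 * (p j * p k * (u j \<bullet> u k)))"
    by (intro sum.cong refl) (simp add: power2_norm_eq_inner inner_diff inner_commute algebra_simps)
  also have "\<dots> = (\<Sum>k\<in>UNIV. p k) * ?s + (\<Sum>j\<in>UNIV. p j) * ?s
      - 2 * (\<Sum>j\<in>UNIV. \<Sum>k\<in>UNIV. p j * p k * (u j \<bullet> u k))"
  proof -
    have "(\<Sum>j\<in>UNIV. \<Sum>k\<in>UNIV. p k * (p j * (norm (u j))\<^sup>2)) = (\<Sum>k\<in>UNIV. p k) * ?s"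
      by (subst sum.swap) (simp add: sum_product)
    moreover have "(\<Sum>j\<in>UNIV. \<Sum>k\<in>UNIV. p j * (p k * (norm (u k))\<^sup>2)) = (\<Sum>j\<in>UNIV. p j) * ?s"
      by (simp add: sum_product)
    ultimately show ?thesis by (simp only: sum.distrib sum_subtractf sum_distrib_left)
  qed
  also have "(\<Sum>j\<in>UNIV. \<Sum>k\<in>UNIV. p j * p k * (u j \<bullet> u k)) = (norm (\<Sum>j\<in>UNIV. p j *\<^sub>R u j))\<^sup>2"
    by (simp add: power2_norm_eq_inner inner_sum_left inner_sum_right sum_distrib_left inner_commute mult_ac)
  finally show ?thesis by (simp add: assms)
qed

text \<open>Unit row sums give the variance identity in each row; unit column sums turn the total of
  the weighted squares back into the unweighted sum.\<close>

lemma doubly_stochastic_norm_decrease: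
  fixes u :: "'i::finite \<Rightarrow> 'a::real_inner"
  assumes "doubly_stochastic W"
  shows "(\<Sum>i\<in>UNIV. (norm (u i))\<^sup>2) - (\<Sum>i\<in>UNIV. (norm (\<Sum>j\<in>UNIV. W $ i $ j *\<^sub>R u j))\<^sup>2)
    = (\<Sum>i\<in>UNIV. \<Sum>j\<in>UNIV. \<Sum>k\<in>UNIV. W $ i $ j * W $ i $ k * (norm (u j - u k))\<^sup>2) / 2"
proof -
  have "(\<Sum>i\<in>UNIV. \<Sum>j\<in>UNIV. W $ i $ j * (norm (u j))\<^sup>2) = (\<Sum>j\<in>UNIV. (\<Sum>i\<in>UNIV. W $ i $ j) * (norm (u j))\<^sup>2)"
    by (subst sum.swap) (simp add: sum_distrib_right)
  also have "\<dots> = (\<Sum>j\<in>UNIV. (norm (u j))\<^sup>2)" using assms by (simp add: doubly_stochastic_def)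
  finally show ?thesis
    using assms weighted_norm_square_sum_diff[of "\<lambda>j. W $ i $ j" u for i, symmetric]
    by (simp add: doubly_stochastic_def sum_divide_distrib sum_subtractf)
qed

lemma graph_on_strongly_connected_rtrancl:
  assumes "strongly_connected (graph_on E)"
  shows "(i, j) \<in> E\<^sup>*"
proof -
  have "arcs_ends (graph_on E) = E"
    by (auto simp: arcs_ends_def arc_to_ends_def graph_on_def)
  moreover have "(i, j) \<in> rtrancl_on (verts (graph_on E)) (arcs_ends (graph_on E))"
    using assms by (auto simp: strongly_connected_def reachable_def graph_on_def)
  then have "(i, j) \<in> (arcs_ends (graph_on E))\<^sup>*" by (rule rtrancl_on_rtranclI)
  ultimately show ?thesis by simp
qed

text \<open>The loss \<open>d u\<close> controls the difference of \<open>u\<close> across each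
  edge, because the row of its head puts weight at least \<eta> on both ends. Paths carry the
  control to all pairs, with constants that do not depend on \<open>u\<close>; as there are finitely
  many pairs, one \<kappa> suffices.\<close>

lemma doubly_stochastic_spectral_gap:
  fixes W :: "real ^ 'i ^ 'i::finite"
  assumes W: "doubly_stochastic W" and conn: "strongly_connected (graph_on E)"
    and edges: "\<And>i j. i \<noteq> j \<Longrightarrow> (j, i) \<in> E \<Longrightarrow> W $ i $ j \<ge> \<eta>"
    and diag: "\<And>i. W $ i $ i \<ge> \<eta>" and "\<eta> > 0"
  obtains \<kappa> where "\<kappa> > 0"
    "\<And>u :: 'i \<Rightarrow> 'a::real_inner. \<kappa> * (\<Sum>i\<in>UNIV. \<Sum>j\<in>UNIV. (norm (u i - u j))\<^sup>2)
       \<le> (\<Sum>i\<in>UNIV. (norm (u i))\<^sup>2) - (\<Sum>i\<in>UNIV. (norm (\<Sum>j\<in>UNIV. W $ i $ j *\<^sub>R u j))\<^sup>2)"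
proof -
  define d where "d u = (\<Sum>i\<in>UNIV. (norm (u i))\<^sup>2)
    - (\<Sum>i\<in>UNIV. (norm (\<Sum>j\<in>UNIV. W $ i $ j *\<^sub>R u j))\<^sup>2)" for u :: "'i \<Rightarrow> 'a"
  have W0: "W $ i $ j \<ge> 0" for i j using W by (simp add: doubly_stochastic_def)
  have d_eq: "d u = (\<Sum>i\<in>UNIV. \<Sum>j\<in>UNIV. \<Sum>k\<in>UNIV. W $ i $ j * W $ i $ k * (norm (u j - u k))\<^sup>2) / 2" for u
    unfolding d_def by (rule doubly_stochastic_norm_decrease[OF W])
  have d0: "d u \<ge> 0" for u
    unfolding d_eq by (intro divide_nonneg_nonneg sum_nonneg mult_nonneg_nonneg W0) auto
  have edge: "norm (u k - u i) \<le> sqrt 2 / \<eta> * sqrt (d u)" if "(k, i) \<in> E" for u i k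
  proof (cases "k = i")
    case False
    \<comment> \<open>Of the nonnegative triple sum only the term of row \<open>i\<close> with
      columns \<open>i\<close> and \<open>k\<close> is kept.\<close>
    have "\<eta> * \<eta> * (norm (u i - u k))\<^sup>2 \<le> W $ i $ i * W $ i $ k * (norm (u i - u k))\<^sup>2"
      using edges[of i k] diag[of i] False that \<open>\<eta> > 0\<close> by (intro mult_right_mono mult_mono) auto
    also have "\<dots> \<le> (\<Sum>k\<in>UNIV. W $ i $ i * W $ i $ k * (norm (u i - u k))\<^sup>2)"
      by (intro member_le_sum mult_nonneg_nonneg W0) auto
    also have "\<dots> \<le> (\<Sum>j\<in>UNIV. \<Sum>k\<in>UNIV. W $ i $ j * W $ i $ k * (norm (u j - u k))\<^sup>2)"
      by (rule member_le_sum[where f = "\<lambda>j. \<Sum>k\<in>UNIV. W $ i $ j * W $ i $ k * (norm (u j - u k))\<^sup>2"])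
         (auto intro!: sum_nonneg mult_nonneg_nonneg W0)
    also have "\<dots> \<le> (\<Sum>i\<in>UNIV. \<Sum>j\<in>UNIV. \<Sum>k\<in>UNIV. W $ i $ j * W $ i $ k * (norm (u j - u k))\<^sup>2)"
      by (rule member_le_sum[where f = "\<lambda>i. \<Sum>j\<in>UNIV. \<Sum>k\<in>UNIV. W $ i $ j * W $ i $ k * (norm (u j - u k))\<^sup>2"])
         (auto intro!: sum_nonneg mult_nonneg_nonneg W0)
    finally have "(\<eta> * norm (u k - u i))\<^sup>2 \<le> 2 * d u"
      by (simp add: d_eq power_mult_distrib norm_minus_commute power2_eq_square mult_ac)
    then have "\<eta> * norm (u k - u i) \<le> sqrt 2 * sqrt (d u)"
      by (metis real_le_rsqrt real_sqrt_mult)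
    then show ?thesis using \<open>\<eta> > 0\<close> by (simp add: field_simps)
  qed (use d0 \<open>\<eta> > 0\<close> in simp)
  \<comment> \<open>The quantifier over \<open>u\<close> stands inside: the constant depends only on
    the path and grows by \<open>sqrt 2 / \<eta>\<close> with each edge.\<close>
  have ex_K: "\<exists>K. \<forall>u. norm (u j - u i) \<le> K * sqrt (d u)" for i j
    using graph_on_strongly_connected_rtrancl[OF conn, of j i]
  proof (induction rule: rtrancl_induct)
    case base
    show ?case by (rule exI[of _ 0]) simp
  next
    case (step k i)
    then obtain K where K: "\<And>u. norm (u j - u k) \<le> K * sqrt (d u)" by blast
    have "norm (u j - u i) \<le> (K + sqrt 2 / \<eta>) * sqrt (d u)" for u
      using norm_triangle_ineq[of "u j - u k" "u k - u i"] K[of u] edge[OF step(2), of u]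
      by (simp add: algebra_simps)
    then show ?case by blast
  qed
  define K where "K i j = (SOME K. \<forall>u. norm (u j - u i) \<le> K * sqrt (d u))" for i j
  have K: "norm (u j - u i) \<le> K i j * sqrt (d u)" for i j u
    unfolding K_def using someI_ex[OF ex_K[of j i]] by blast
  \<comment> \<open>The summand 1 keeps \<open>c\<close> positive when all path constants vanish.
    The indices of \<open>K\<close> are swapped because \<open>K i j\<close> bounds
    \<open>u j - u i\<close>.\<close>
  define c where "c = 1 + (\<Sum>i\<in>UNIV. \<Sum>j\<in>UNIV. (K j i)\<^sup>2)"
  have c: "c > 0" unfolding c_def by (intro add_pos_nonneg sum_nonneg) auto
  have "1 / c * (\<Sum>i\<in>UNIV. \<Sum>j\<in>UNIV. (norm (u i - u j))\<^sup>2) \<le> d u" for u :: "'i \<Rightarrow> 'a"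
  proof -
    have "(norm (u i - u j))\<^sup>2 \<le> (K j i)\<^sup>2 * d u" for i j
      using power_mono[OF K[of u i j], of 2] d0[of u] by (simp add: power_mult_distrib)
    then have "(\<Sum>i\<in>UNIV. \<Sum>j\<in>UNIV. (norm (u i - u j))\<^sup>2) \<le> (\<Sum>i\<in>UNIV. \<Sum>j\<in>UNIV. (K j i)\<^sup>2 * d u)"
      by (intro sum_mono)
    also have "\<dots> \<le> c * d u"
      using d0[of u] by (simp add: c_def sum_distrib_right distrib_right)
    finally show ?thesis using c by (simp add: field_simps)
  qed
  then show thesis using c by (intro that[of "1 / c"]) (auto simp: d_def)
qed

section \<open>Weighted means and the scalar recursion\<close>

definition weighted_mean :: "('i::finite \<Rightarrow> real) \<Rightarrow> ('i \<Rightarrow> 'a::real_vector) \<Rightarrow> 'a" where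
  "weighted_mean \<pi> u = (1 / (\<Sum>i\<in>UNIV. \<pi> i)) *\<^sub>R (\<Sum>i\<in>UNIV. \<pi> i *\<^sub>R u i)"

text \<open>The weighted deviations from the mean sum to 0, so the cross terms vanish and moving the
  center to \<open>c\<close> adds a nonnegative multiple of
  \<open>(norm (?m - c))\<^sup>2\<close>.\<close>

lemma weighted_mean_minimizes:
  fixes u :: "'i::finite \<Rightarrow> 'a::real_inner"
  assumes \<pi>: "\<And>i. \<pi> i > 0"
  shows "(\<Sum>i\<in>UNIV. \<pi> i * (norm (u i - weighted_mean \<pi> u))\<^sup>2) \<le> (\<Sum>i\<in>UNIV. \<pi> i * (norm (u i - c))\<^sup>2)"
proof -
  let ?m = "weighted_mean \<pi> u" and ?P = "\<Sum>i\<in>UNIV. \<pi> i"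
  have P: "?P > 0" using \<pi> by (intro sum_pos) auto
  have "(\<Sum>i\<in>UNIV. \<pi> i *\<^sub>R (u i - ?m)) = (\<Sum>i\<in>UNIV. \<pi> i *\<^sub>R u i) - ?P *\<^sub>R ?m"
    by (simp add: scaleR_diff_right sum_subtractf scaleR_sum_left)
  also have "\<dots> = 0" using P by (simp add: weighted_mean_def)
  finally have z: "(\<Sum>i\<in>UNIV. \<pi> i *\<^sub>R (u i - ?m)) = 0" .
  have "(\<Sum>i\<in>UNIV. \<pi> i * (norm (u i - c))\<^sup>2)
      = (\<Sum>i\<in>UNIV. \<pi> i * (norm (u i - ?m))\<^sup>2 + 2 * ((\<pi> i *\<^sub>R (u i - ?m)) \<bullet> (?m - c)) + \<pi> i * (norm (?m - c))\<^sup>2)"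
  proof (intro sum.cong refl)
    fix i
    have "u i - c = (u i - ?m) + (?m - c)" by simp
    then have eq: "(norm (u i - c))\<^sup>2 = (norm (u i - ?m))\<^sup>2 + 2 * ((u i - ?m) \<bullet> (?m - c)) + (norm (?m - c))\<^sup>2"
      by (simp only: power2_norm_eq_inner inner_add_left inner_add_right) (simp add: inner_commute)
    show "\<pi> i * (norm (u i - c))\<^sup>2
        = \<pi> i * (norm (u i - ?m))\<^sup>2 + 2 * ((\<pi> i *\<^sub>R (u i - ?m)) \<bullet> (?m - c)) + \<pi> i * (norm (?m - c))\<^sup>2"
      unfolding eq by (simp add: distrib_left)
  qed
  also have "\<dots> = (\<Sum>i\<in>UNIV. \<pi> i * (norm (u i - ?m))\<^sup>2)
      + 2 * ((\<Sum>i\<in>UNIV. \<pi> i *\<^sub>R (u i - ?m)) \<bullet> (?m - c)) + ?P * (norm (?m - c))\<^sup>2"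
    by (simp add: sum.distrib inner_sum_left sum_distrib_left sum_distrib_right)
  finally show ?thesis using P by (simp add: z)
qed

text \<open>Young's inequality for the cross term. A small \<epsilon> keeps the factor of
  \<open>a\<close> near 1 at the expense of the factor of \<open>b\<close>.\<close>

lemma norm_add_square_le:
  fixes a b :: "'a::real_inner"
  assumes "\<epsilon> > 0"
  shows "(norm (a + b))\<^sup>2 \<le> (1 + \<epsilon>) * (norm a)\<^sup>2 + (1 + 1 / \<epsilon>) * (norm b)\<^sup>2"
proof -
  have "0 \<le> (sqrt \<epsilon> * norm a - norm b / sqrt \<epsilon>)\<^sup>2" by simp
  also have "\<dots> = \<epsilon> * (norm a)\<^sup>2 + (norm b)\<^sup>2 / \<epsilon> - 2 * (norm a * norm b)"
    using assms by (simp add: power2_diff power_mult_distrib power_divide)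
  finally have "2 * (norm a * norm b) \<le> \<epsilon> * (norm a)\<^sup>2 + (norm b)\<^sup>2 / \<epsilon>" by simp
  moreover have "(norm (a + b))\<^sup>2 \<le> (norm a + norm b)\<^sup>2"
    by (intro power_mono norm_triangle_ineq norm_ge_zero)
  ultimately show ?thesis by (simp add: power2_sum algebra_simps)
qed

text \<open>Summing the recursion bounds all partial sums of \<open>v\<close>, so \<open>v\<close>
  is summable. The argument works for either sign of \<rho>.\<close>

lemma contraction_tendsto_zero:
  fixes v \<delta> :: "nat \<Rightarrow> real"
  assumes "\<rho> < 1" "\<And>t. v t \<ge> 0" "\<And>t. \<delta> t \<ge> 0" "summable \<delta>"
    and step: "\<And>t. v (Suc t) \<le> \<rho> * v t + \<delta> t"
  shows "v \<longlonglongrightarrow> 0"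
proof -
  have *: "(1 - \<rho>) * (\<Sum>t<T. v t) + v T \<le> v 0 + (\<Sum>t<T. \<delta> t)" for T
  proof (induction T)
    case (Suc T)
    then show ?case using step[of T] by (simp add: algebra_simps)
  qed simp
  have "(\<Sum>t<T. v t) \<le> (v 0 + suminf \<delta>) / (1 - \<rho>)" for T
  proof -
    have "(\<Sum>t<T. \<delta> t) \<le> suminf \<delta>" using assms(3,4) by (intro sum_le_suminf) auto
    then have "(1 - \<rho>) * (\<Sum>t<T. v t) \<le> v 0 + suminf \<delta>" using *[of T] assms(2)[of T] by linarith
    then show ?thesis using assms(1) by (simp add: field_simps)
  qed
  then have "summable v" using assms(2) by (intro summableI_nonneg_bounded) auto
  then show ?thesis by (rule summable_LIMSEQ_zero)
qed

section \<open>Independence and blocks\<close>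

context prob_space
begin

section \<open>Independent pairs and second moments\<close>

text \<open>Independence of the generated sigma-algebras is the product rule on rectangles, and
  rectangles determine the product of two probability laws.\<close>

lemma distr_pair_indep:
  assumes X [measurable]: "X \<in> measurable M S" and Y [measurable]: "Y \<in> measurable M T"
    and indep: "indep_set (generated_events M S X) (generated_events M T Y)"
  shows "distr M S X \<Otimes>\<^sub>M distr M T Y = distr M (S \<Otimes>\<^sub>M T) (\<lambda>w. (X w, Y w))"
proof (rule pair_measure_eqI)
  show "sigma_finite_measure (distr M S X)" "sigma_finite_measure (distr M T Y)"
    by (simp_all add: prob_space_distr prob_space_imp_sigma_finite)
  fix A B assume AB: "A \<in> sets (distr M S X)" "B \<in> sets (distr M T Y)"
  have eq: "(\<lambda>w. (X w, Y w)) -` (A \<times> B) \<inter> space M = (X -` A \<inter> space M) \<inter> (Y -` B \<inter> space M)"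
    by auto
  have "prob ((X -` A \<inter> space M) \<inter> (Y -` B \<inter> space M)) = prob (X -` A \<inter> space M) * prob (Y -` B \<inter> space M)"
    using AB by (intro indep_setD[OF indep]) (auto simp: generated_events_def in_vimage_algebra)
  then show "emeasure (distr M S X) A * emeasure (distr M T Y) B
      = emeasure (distr M (S \<Otimes>\<^sub>M T) (\<lambda>w. (X w, Y w))) (A \<times> B)"
    using AB by (simp add: emeasure_distr eq emeasure_eq_measure ennreal_mult)
qed simp

text \<open>Fubini for the product law: \<open>X\<close> may be frozen while \<open>Y\<close> is
  averaged. Later \<open>X\<close> is the point at which a subgradient is taken and \<open>Y\<close>
  is the fresh sample.\<close>

lemma nn_integral_indep_pair:
  assumes X [measurable]: "X \<in> measurable M S" and Y [measurable]: "Y \<in> measurable M T"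
    and indep: "indep_set (generated_events M S X) (generated_events M T Y)"
    and f [measurable]: "f \<in> borel_measurable (S \<Otimes>\<^sub>M T)"
  shows "(\<integral>\<^sup>+w. f (X w, Y w) \<partial>M) = (\<integral>\<^sup>+w. (\<integral>\<^sup>+z. f (X w, z) \<partial>distr M T Y) \<partial>M)"
proof -
  interpret T: sigma_finite_measure "distr M T Y"
    by (simp add: prob_space_distr prob_space_imp_sigma_finite)
  have "(\<integral>\<^sup>+w. f (X w, Y w) \<partial>M) = (\<integral>\<^sup>+p. f p \<partial>(distr M S X \<Otimes>\<^sub>M distr M T Y))"
    by (simp add: distr_pair_indep[OF X Y indep] nn_integral_distr)
  also have "\<dots> = (\<integral>\<^sup>+v. (\<integral>\<^sup>+z. f (v, z) \<partial>distr M T Y) \<partial>distr M S X)"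
    by (rule T.nn_integral_fst[symmetric]) simp
  also have "\<dots> = (\<integral>\<^sup>+w. (\<integral>\<^sup>+z. f (X w, z) \<partial>distr M T Y) \<partial>M)"
    by (rule nn_integral_distr) measurable
  finally show ?thesis .
qed

lemma expectation_indicator_mult:
  assumes A: "A \<in> \<A>" and indep: "indep_set \<A> (generated_events M borel \<phi>)"
    and int: "integrable M \<phi>"
  shows "expectation (\<lambda>w. indicator A w * \<phi> w) = prob A * expectation \<phi>"
proof -
  have [measurable]: "A \<in> events" using indep_setD_ev1[OF indep] A by auto
  have [measurable]: "\<phi> \<in> borel_measurable M" using int by auto
  \<comment> \<open>The family \<open>\<A>\<close> need not be a sigma-algebra, so independence is
    extended from the intersection-stable generator \<open>{A}\<close>, whose sigma-algebra contains
    all events of the indicator.\<close>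
  have sub: "generated_events M borel (indicator A :: 'a \<Rightarrow> real) \<subseteq> sigma_sets (space M) {A}"
    unfolding generated_events_def
  proof (subst sets_measure_of[symmetric])
    have "(indicator A :: 'a \<Rightarrow> real) \<in> borel_measurable (sigma (space M) {A})"
      using sets.sets_into_space[of A M] by (intro borel_measurable_indicator) (auto simp: sets_measure_of)
    then show "sets (vimage_algebra (space M) (indicator A :: 'a \<Rightarrow> real) borel) \<subseteq> sets (sigma (space M) {A})"
      by (intro sets_image_in_sets) (simp_all add: space_measure_of_conv)
  qed (use sets.sets_into_space[of A M] in auto)
  have "indep_set {A} (generated_events M borel \<phi>)"
    using indep A unfolding indep_sets2_eq by auto
  then have "indep_set (sigma_sets (space M) {A}) (sigma_sets (space M) (generated_events M borel \<phi>))"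
    by (rule indep_set_sigma_sets) (auto simp: Int_stable_def generated_events_def)
  moreover have "sigma_sets (space M) (generated_events M borel \<phi>) = generated_events M borel \<phi>"
    using sets.sigma_sets_eq[of "vimage_algebra (space M) \<phi> borel"] by (simp add: generated_events_def)
  ultimately have "indep_set (generated_events M borel (indicator A :: 'a \<Rightarrow> real)) (generated_events M borel \<phi>)"
    using sub unfolding indep_sets2_eq by auto
  then have "indep_var borel (indicator A :: 'a \<Rightarrow> real) borel \<phi>"
    by (simp add: indep_var_eq generated_events_def sets_vimage_algebra)
  then have "expectation (\<lambda>w. indicator A w * \<phi> w) = expectation (indicator A) * expectation \<phi>"
    using int by (intro indep_var_lebesgue_integral integrable_real_indicator) (auto simp: emeasure_eq_measure)
  then show ?thesis by simp
qed

text \<open>The variance is nonnegative; this passes from second moments to the first moment of the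
  consensus error.\<close>

lemma expectation_square_le:
  fixes f :: "'a \<Rightarrow> real"
  assumes "f \<in> borel_measurable M" "integrable M (\<lambda>w. (f w)\<^sup>2)"
  shows "integrable M f" and "(expectation f)\<^sup>2 \<le> expectation (\<lambda>w. (f w)\<^sup>2)"
proof -
  show int: "integrable M f" by (rule square_integrable_imp_integrable[OF assms])
  show "(expectation f)\<^sup>2 \<le> expectation (\<lambda>w. (f w)\<^sup>2)"
    using variance_eq[OF int assms(2)] variance_positive[of f] by simp
qed

end

section \<open>Histories and coordinate blocks\<close>

lemma fst_history: "fst (history x0 s l \<xi> t w) i = x0 i w"
  by (simp add: history_def)

lemma snd_history: "\<tau> < t \<Longrightarrow> snd (history x0 s l \<xi> t w) \<tau> = iteration_draws s l \<xi> \<tau> w"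
  by (simp add: history_def)

lemma linear_block: "linear (block blk b)"
  by (rule linearI) (auto simp: block_def vec_eq_iff)

lemma borel_measurable_block [measurable]: "block blk b \<in> borel_measurable borel"
  by (intro borel_measurable_continuous_onI linear_continuous_on linear_linear[THEN iffD2] linear_block)

lemma sum_block: "(\<Sum>b\<in>UNIV. block blk b v) = v" for blk :: "'n::finite \<Rightarrow> 'b::finite"
  by (simp add: vec_eq_iff block_def)

lemma norm_block_le: "norm (block blk b v) \<le> norm v"
  unfolding norm_vec_def by (intro L2_set_mono) (auto simp: block_def)

section \<open>The expected disagreement\<close>

text \<open>Here \<open>q i b\<close> is the probability that agent \<open>i\<close> is awake and
  draws block \<open>b\<close>. Awake flags and block draws enter through this joint update event,
  and its product form is inserted when the locale is interpreted.\<close>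

locale block_proximal_run = prob_space M
  for M :: "'w measure"
    and D :: "'i::finite \<Rightarrow> 'z measure"
    and g :: "'i \<Rightarrow> real ^ 'n::finite \<Rightarrow> 'z \<Rightarrow> real ^ 'n"
    and blk :: "'n \<Rightarrow> 'b::finite"
    and X :: "'b \<Rightarrow> (real ^ 'n) set"
    and \<omega> :: "'b \<Rightarrow> real ^ 'n \<Rightarrow> real"
    and d\<omega> :: "'b \<Rightarrow> real ^ 'n \<Rightarrow> real ^ 'n"
    and \<sigma> :: "'b \<Rightarrow> real"
    and W :: "real ^ 'i ^ 'i"
    and s :: "'i \<Rightarrow> nat \<Rightarrow> 'w \<Rightarrow> bool"
    and l :: "'i \<Rightarrow> nat \<Rightarrow> 'w \<Rightarrow> 'b"
    and \<xi> :: "'i \<Rightarrow> nat \<Rightarrow> 'w \<Rightarrow> 'z"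
    and q :: "'i \<Rightarrow> 'b \<Rightarrow> real"
    and \<alpha> :: "'i \<Rightarrow> nat \<Rightarrow> real"
    and x y :: "'i \<Rightarrow> nat \<Rightarrow> 'w \<Rightarrow> real ^ 'n"
    and Gbar :: "'i \<Rightarrow> real" +
  assumes g_measurable: "\<And>i. (\<lambda>(u, z). g i u z) \<in> borel_measurable (borel \<Otimes>\<^sub>M D i)"
    and X_closed: "\<And>b. closed (X b)"
    and X_convex: "\<And>b. convex (X b)"
    and omega_C1: "\<And>b. C1_on (X b) (\<omega> b) (d\<omega> b)"
    and sigma_pos: "\<And>b. \<sigma> b > 0"
    and omega_strongly_convex: "\<And>b. strongly_convex_on (\<sigma> b) (X b) (\<omega> b)"
    and W_doubly_stochastic: "doubly_stochastic W"
    and q_pos: "\<And>i b. q i b > 0"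
    and s_measurable: "\<And>i t. s i t \<in> measurable M (count_space UNIV)"
    and l_measurable: "\<And>i t. l i t \<in> measurable M (count_space UNIV)"
    and xi_measurable: "\<And>i t. \<xi> i t \<in> measurable M (D i)"
    and x0_measurable: "\<And>i. x i 0 \<in> borel_measurable M"
    and update_prob: "\<And>i t b. prob {w \<in> space M. s i t w \<and> l i t w = b} = q i b"
    and xi_distr: "\<And>i t. distr M (D i) (\<xi> i t) = D i"
    and indep_past: "\<And>t. indep_set
           (generated_events M (iteration_space D) (iteration_draws s l \<xi> t))
           (generated_events M (history_space D t) (history (\<lambda>i. x i 0) s l \<xi> t))"
    and x0_feasible: "\<And>i w. w \<in> space M \<Longrightarrow> x i 0 w \<in> block_product blk X"
    and x0_bounded: "\<And>i. \<exists>R. AE w in M. norm (x i 0 w) \<le> R"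
    and y_def: "\<And>i t w. w \<in> space M \<Longrightarrow> y i t w = (\<Sum>j\<in>UNIV. W $ i $ j *\<^sub>R x j t w)"
    and x_awake: "\<And>i t w. w \<in> space M \<Longrightarrow> s i t w \<Longrightarrow>
           block blk (l i t w) (x i (Suc t) w) =
             prox (X (l i t w)) (\<omega> (l i t w)) (d\<omega> (l i t w))
               (block blk (l i t w) (y i t w))
               (block blk (l i t w) (g i (y i t w) (\<xi> i t w)))
               (\<alpha> i t)"
    and x_other_blocks: "\<And>i t w b. w \<in> space M \<Longrightarrow> s i t w \<Longrightarrow> b \<noteq> l i t w \<Longrightarrow>
           block blk b (x i (Suc t) w) = block blk b (x i t w)"
    and x_idle: "\<And>i t w. w \<in> space M \<Longrightarrow> \<not> s i t w \<Longrightarrow> x i (Suc t) w = x i t w"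
    and alpha_pos: "\<And>i t. \<alpha> i t > 0"
    and g_square_integrable: "\<And>i u. integrable (D i) (\<lambda>z. (norm (g i u z))\<^sup>2)"
    and g_square_bound: "\<And>i u. (\<integral>z. (norm (g i u z))\<^sup>2 \<partial>D i) \<le> Gbar i"
begin

lemma mirror_map: "mirror_map (X b) (\<omega> b) (d\<omega> b) (\<sigma> b)"
proof
  \<comment> \<open>A feasible start at some sample point supplies an element of \<open>X b\<close>;
    \<open>undefined\<close> stands for an arbitrary agent.\<close>
  obtain w where "w \<in> space M" using not_empty by auto
  then have "block blk b (x undefined 0 w) \<in> X b"
    using x0_feasible by (auto simp: block_product_def)
  then show "X b \<noteq> {}" by auto
qed (use X_closed omega_C1 sigma_pos omega_strongly_convex in auto)

sublocale mirror: mirror_map "X b" "\<omega> b" "d\<omega> b" "\<sigma> b" for b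
  by (rule mirror_map)

abbreviation update :: "'b \<Rightarrow> 'i \<Rightarrow> nat \<Rightarrow> 'w \<Rightarrow> bool" where
  "update b i t w \<equiv> s i t w \<and> l i t w = b"

abbreviation u :: "'b \<Rightarrow> 'i \<Rightarrow> nat \<Rightarrow> 'w \<Rightarrow> real ^ 'n" where
  "u b i t w \<equiv> block blk b (x i t w)"

text \<open>The filtration of the algorithm: everything decided before the draws of iteration
  \<open>t\<close>.\<close>

abbreviation past :: "nat \<Rightarrow> 'w measure" where
  "past t \<equiv> vimage_algebra (space M) (history (\<lambda>i. x i 0) s l \<xi> t) (history_space D t)"

lemma block_y:
  "w \<in> space M \<Longrightarrow> block blk b (y i t w) = (\<Sum>j\<in>UNIV. W $ i $ j *\<^sub>R u b j t w)"
  by (simp add: y_def linear_sum[OF linear_block] linear_scale[OF linear_block])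

text \<open>The awake, unselected and idle rules merge into one conditional, so that each block
  follows its own recursion. Blocks interact only through the subgradient, which is taken at the
  whole vector \<open>y i t w\<close>.\<close>

lemma u_Suc:
  assumes "w \<in> space M"
  shows "u b i (Suc t) w =
    (if update b i t w
     then prox (X b) (\<omega> b) (d\<omega> b) (block blk b (y i t w)) (block blk b (g i (y i t w) (\<xi> i t w))) (\<alpha> i t)
     else u b i t w)"
  using assms x_awake[of w i t] x_other_blocks[of w i t b] x_idle[of w i t]
  by (cases "s i t w"; cases "l i t w = b") auto

lemma block_y_in:
  assumes "w \<in> space M" "\<And>j. u b j t w \<in> X b"
  shows "block blk b (y i t w) \<in> X b"
  unfolding block_y[OF assms(1)] using assms(2) W_doubly_stochastic
  by (intro convex_sum X_convex) (auto simp: doubly_stochastic_def)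

lemma u_in: "w \<in> space M \<Longrightarrow> u b i t w \<in> X b"
proof (induction t arbitrary: i)
  case 0
  then show ?case using x0_feasible by (auto simp: block_product_def)
next
  case (Suc t)
  then show ?case using mirror.prox_in[of "\<alpha> i t" b] alpha_pos by (simp add: u_Suc)
qed

section \<open>Adaptedness of the iterates\<close>

lemma iteration_draws_measurable [measurable]:
  "iteration_draws s l \<xi> t \<in> measurable M (iteration_space D)"
proof -
  note [measurable] = s_measurable l_measurable xi_measurable
  show ?thesis
    unfolding iteration_draws_def iteration_space_def
    by (rule measurable_PiM_single') (auto simp: space_pair_measure measurable_space[OF xi_measurable])
qed

lemma history_measurable [measurable]:
  "history (\<lambda>i. x i 0) s l \<xi> t \<in> measurable M (history_space D t)"
proof -
  note [measurable] = x0_measurable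
  have [measurable]: "(\<lambda>w i. x i 0 w) \<in> measurable M (\<Pi>\<^sub>M i\<in>UNIV. borel)"
    by (rule measurable_PiM_single') auto
  show ?thesis
    unfolding history_def history_space_def by measurable
qed

lemma history_measurable_past:
  "history (\<lambda>i. x i 0) s l \<xi> t \<in> measurable (past t) (history_space D t)"
  by (intro measurable_vimage_algebra1) (auto dest: measurable_space[OF history_measurable])

lemma past_le: "sets (past t) \<subseteq> sets M"
  by (intro sets_image_in_sets) auto

lemma measurable_past_imp: "f \<in> measurable (past t) N \<Longrightarrow> f \<in> measurable M N"
  by (rule measurable_mono[OF order_refl refl past_le, THEN subsetD]) simp_all

text \<open>Restricting the draws of the longer history to the first \<open>t\<close> iterations
  recovers the shorter one, and this restriction is measurable.\<close>

lemma past_le_Suc: "sets (past t) \<subseteq> sets (past (Suc t))"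
proof (intro sets_image_in_sets)
  have "(\<lambda>h. (fst h, restrict (snd h) {..<t})) \<in> measurable (history_space D (Suc t)) (history_space D t)"
    unfolding history_space_def
    by (intro measurable_Pair measurable_fst measurable_compose[OF measurable_snd measurable_restrict_subset]) auto
  note measurable_compose[OF history_measurable_past this]
  moreover have "(fst (history (\<lambda>i. x i 0) s l \<xi> (Suc t) w), restrict (snd (history (\<lambda>i. x i 0) s l \<xi> (Suc t) w)) {..<t})
      = history (\<lambda>i. x i 0) s l \<xi> t w" for w
    by (auto simp: history_def restrict_def)
  ultimately show "history (\<lambda>i. x i 0) s l \<xi> t \<in> measurable (past (Suc t)) (history_space D t)"
    by simp
qed simp

lemma measurable_past_Suc: "f \<in> measurable (past t) N \<Longrightarrow> f \<in> measurable (past (Suc t)) N"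
  by (rule measurable_mono[OF order_refl refl past_le_Suc, THEN subsetD]) simp_all

lemma draws_measurable_past: "iteration_draws s l \<xi> t \<in> measurable (past (Suc t)) (iteration_space D)"
proof -
  have "(\<lambda>h. snd h t) \<in> measurable (history_space D (Suc t)) (iteration_space D)"
    unfolding history_space_def
    by (rule measurable_compose[OF measurable_snd measurable_component_singleton]) simp
  from measurable_compose[OF history_measurable_past this] show ?thesis
    by (simp add: snd_history)
qed

lemma
  shows update_measurable_draws: "(\<lambda>d. fst (d i) \<and> fst (snd (d i)) = b) \<in> measurable (iteration_space D) (count_space UNIV)"
    and sample_measurable_draws: "(\<lambda>d. snd (snd (d i))) \<in> measurable (iteration_space D) (D i)"
proof -
  have [measurable]: "(\<lambda>d. d i) \<in> measurable (iteration_space D)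
      (count_space UNIV \<Otimes>\<^sub>M count_space UNIV \<Otimes>\<^sub>M D i)"
    unfolding iteration_space_def by measurable
  show "(\<lambda>d. fst (d i) \<and> fst (snd (d i)) = b) \<in> measurable (iteration_space D) (count_space UNIV)"
    by measurable
  show "(\<lambda>d. snd (snd (d i))) \<in> measurable (iteration_space D) (D i)"
    by measurable
qed

text \<open>Induction on time: \<open>y i t\<close>, the draws of iteration \<open>t\<close> and the
  proximal map are measurable for the next history. This gives measurable blocks, and the vector is
  the sum of its blocks.\<close>

lemma x_measurable_past: "x i t \<in> borel_measurable (past t)"
proof (induction t arbitrary: i)
  case 0
  have "(\<lambda>h. fst h i) \<in> borel_measurable (history_space D 0)"
    unfolding history_space_def
    by (rule measurable_compose[OF measurable_fst measurable_component_singleton]) simp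
  from measurable_compose[OF history_measurable_past this] show ?case
    by (simp add: fst_history)
next
  case (Suc t)
  let ?F = "past (Suc t)"
  note [measurable] = Suc.IH[THEN measurable_past_Suc]
  have y: "y i t \<in> borel_measurable ?F"
    by (subst measurable_cong[OF y_def]) auto
  have [measurable]: "Measurable.pred ?F (\<lambda>w. update b i t w)" for b
    using measurable_compose[OF draws_measurable_past update_measurable_draws]
    by (simp add: iteration_draws_def)
  have [measurable]: "\<xi> i t \<in> measurable ?F (D i)"
    using measurable_compose[OF draws_measurable_past sample_measurable_draws]
    by (simp add: iteration_draws_def)
  have g: "(\<lambda>w. g i (y i t w) (\<xi> i t w)) \<in> borel_measurable ?F"
    using measurable_compose[OF measurable_Pair[OF y \<open>\<xi> i t \<in> _\<close>] g_measurable] by simp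
  have P: "(\<lambda>w. prox (X b) (\<omega> b) (d\<omega> b) (block blk b (y i t w)) (block blk b (g i (y i t w) (\<xi> i t w))) (\<alpha> i t))
      \<in> borel_measurable ?F" for b
    using y g by (intro mirror.borel_measurable_prox alpha_pos) (auto intro: block_y_in u_in)
  have "u b i (Suc t) \<in> borel_measurable ?F" for b
    by (subst measurable_cong[OF u_Suc]) (use P in auto)
  then have "(\<lambda>w. \<Sum>b\<in>UNIV. u b i (Suc t) w) \<in> borel_measurable ?F"
    by measurable
  then show ?case by (simp add: sum_block)
qed

lemmas x_measurable [measurable] = x_measurable_past[THEN measurable_past_imp]

lemma y_measurable_past: "y i t \<in> borel_measurable (past t)"
proof -
  note [measurable] = x_measurable_past
  show ?thesis by (subst measurable_cong[OF y_def]) auto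
qed

lemmas y_measurable [measurable] = y_measurable_past[THEN measurable_past_imp]

section \<open>Averaging over fresh draws\<close>

text \<open>Both generated sigma-algebras are contained in the two whose independence is assumed,
  and independence passes to subfamilies.\<close>

lemma indep_past_draws:
  assumes Y: "Y \<in> measurable (iteration_space D) S" and \<phi>: "\<phi> \<in> measurable (past t) N"
  shows "indep_set (generated_events M S (\<lambda>w. Y (iteration_draws s l \<xi> t w))) (generated_events M N \<phi>)"
proof -
  have "iteration_draws s l \<xi> t
      \<in> measurable (vimage_algebra (space M) (iteration_draws s l \<xi> t) (iteration_space D)) (iteration_space D)"
    by (intro measurable_vimage_algebra1) (auto dest: measurable_space[OF iteration_draws_measurable])
  from measurable_compose[OF this Y]
  have "generated_events M S (\<lambda>w. Y (iteration_draws s l \<xi> t w))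
      \<subseteq> generated_events M (iteration_space D) (iteration_draws s l \<xi> t)"
    unfolding generated_events_def by (intro sets_image_in_sets) auto
  moreover have "generated_events M N \<phi> \<subseteq> generated_events M (history_space D t) (history (\<lambda>i. x i 0) s l \<xi> t)"
    unfolding generated_events_def using \<phi> by (intro sets_image_in_sets) auto
  ultimately show ?thesis using indep_past[of t] unfolding indep_sets2_eq by blast
qed

lemma expectation_update_mult:
  assumes "\<phi> \<in> borel_measurable (past t)" "integrable M \<phi>"
  shows "expectation (\<lambda>w. of_bool (update b i t w) * \<phi> w) = q i b * expectation \<phi>"
proof -
  let ?A = "{w \<in> space M. update b i t w}"
  have ind: "indep_set (generated_events M (count_space UNIV) (update b i t)) (generated_events M borel \<phi>)"
    using indep_past_draws[OF update_measurable_draws assms(1)] by (simp add: iteration_draws_def)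
  have "?A = update b i t -` {True} \<inter> space M" by auto
  also have "\<dots> \<in> generated_events M (count_space UNIV) (update b i t)"
    unfolding generated_events_def by (intro in_vimage_algebra) auto
  finally have "expectation (\<lambda>w. indicator ?A w * \<phi> w) = q i b * expectation \<phi>"
    using expectation_indicator_mult[OF _ ind assms(2)] by (simp add: update_prob)
  then show ?thesis by (simp add: indicator_def of_bool_def cong: Bochner_Integration.integral_cong)
qed

lemma Gbar_nonneg: "0 \<le> Gbar i"
proof -
  have "0 \<le> (\<integral>z. (norm (g i 0 z))\<^sup>2 \<partial>D i)" by simp
  then show ?thesis using g_square_bound[of i 0] by linarith
qed

text \<open>The point \<open>y i t\<close> is determined by the past and the sample is fresh, so the
  uniform bound on the second moment applies with the point frozen. Nonnegative integrals come
  first, so that integrability is a consequence of the bound.\<close>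

lemma
  shows subgradient_square_integrable: "integrable M (\<lambda>w. (norm (g i (y i t w) (\<xi> i t w)))\<^sup>2)"
    and subgradient_square_le: "expectation (\<lambda>w. (norm (g i (y i t w) (\<xi> i t w)))\<^sup>2) \<le> Gbar i"
proof -
  note [measurable] = xi_measurable g_measurable
  have ind': "indep_set (generated_events M (D i) (\<xi> i t)) (generated_events M borel (y i t))"
    using indep_past_draws[OF sample_measurable_draws y_measurable_past] by (simp add: iteration_draws_def)
  have ind: "indep_set (generated_events M borel (y i t)) (generated_events M (D i) (\<xi> i t))"
  proof (intro indep_setI)
    fix a b assume "a \<in> generated_events M borel (y i t)" "b \<in> generated_events M (D i) (\<xi> i t)"
    with indep_setD[OF ind', of b a] show "prob (a \<inter> b) = prob a * prob b"
      by (simp add: Int_commute mult.commute)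
  qed (use indep_setD_ev1[OF ind'] indep_setD_ev2[OF ind'] in auto)
  let ?f = "\<lambda>p. ennreal ((norm (g i (fst p) (snd p)))\<^sup>2)"
  have [measurable]: "(\<lambda>p. g i (fst p) (snd p)) \<in> borel_measurable (borel \<Otimes>\<^sub>M D i)"
    using g_measurable[of i] by (simp add: case_prod_beta')
  have "(\<integral>\<^sup>+w. ?f (y i t w, \<xi> i t w) \<partial>M) = (\<integral>\<^sup>+w. (\<integral>\<^sup>+z. ?f (y i t w, z) \<partial>D i) \<partial>M)"
    by (subst nn_integral_indep_pair[OF y_measurable xi_measurable ind]) (simp_all add: xi_distr)
  also have "\<dots> \<le> (\<integral>\<^sup>+w. ennreal (Gbar i) \<partial>M)"
    using g_square_bound
    by (intro nn_integral_mono) (simp add: nn_integral_eq_integral[OF g_square_integrable] ennreal_leI)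
  finally have le: "(\<integral>\<^sup>+w. ennreal ((norm (g i (y i t w) (\<xi> i t w)))\<^sup>2) \<partial>M) \<le> ennreal (Gbar i)"
    by (simp add: emeasure_space_1)
  have [measurable]: "(\<lambda>w. g i (y i t w) (\<xi> i t w)) \<in> borel_measurable M"
    using measurable_compose[OF measurable_Pair[OF y_measurable xi_measurable] g_measurable] by simp
  show int: "integrable M (\<lambda>w. (norm (g i (y i t w) (\<xi> i t w)))\<^sup>2)"
    using le by (intro integrableI_bounded) (auto intro: order_le_less_trans)
  show "expectation (\<lambda>w. (norm (g i (y i t w) (\<xi> i t w)))\<^sup>2) \<le> Gbar i"
    using le Gbar_nonneg by (simp add: nn_integral_eq_integral[OF int])
qed

section \<open>Mixing without the proximal perturbation\<close>

text \<open>The next block if an update only averaged and took no proximal step. Its difference from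
  the actual block is of the order of the stepsize.\<close>

definition mixed :: "'b \<Rightarrow> 'i \<Rightarrow> nat \<Rightarrow> 'w \<Rightarrow> real ^ 'n" where
  "mixed b i t w = (if update b i t w then block blk b (y i t w) else u b i t w)"

lemma u_Suc_mixed_dist:
  assumes "w \<in> space M"
  shows "(norm (u b i (Suc t) w - mixed b i t w))\<^sup>2
    \<le> (\<alpha> i t / \<sigma> b)\<^sup>2 * (norm (g i (y i t w) (\<xi> i t w)))\<^sup>2"
proof -
  have "norm (u b i (Suc t) w - mixed b i t w) \<le> \<alpha> i t / \<sigma> b * norm (g i (y i t w) (\<xi> i t w))"
  proof (cases "update b i t w")
    case True
    then have "norm (u b i (Suc t) w - mixed b i t w)
        \<le> \<alpha> i t / \<sigma> b * norm (block blk b (g i (y i t w) (\<xi> i t w)))"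
      unfolding u_Suc[OF assms] mixed_def if_P[OF True]
      by (intro mirror.prox_dist_le alpha_pos block_y_in u_in assms)
    also have "\<dots> \<le> \<alpha> i t / \<sigma> b * norm (g i (y i t w) (\<xi> i t w))"
      using alpha_pos[of i t] sigma_pos[of b] by (intro mult_left_mono norm_block_le) auto
    finally show ?thesis .
  next
    case False
    then show ?thesis using alpha_pos[of i t] sigma_pos[of b]
      unfolding u_Suc[OF assms] mixed_def if_not_P[OF False] by simp
  qed
  from power_mono[OF this norm_ge_zero, of 2] show ?thesis by (simp only: power_mult_distrib)
qed

text \<open>Jensen's inequality for the squared norm: the variance under the weights of row
  \<open>i\<close> is nonnegative.\<close>

lemma block_y_norm_square_le:
  assumes "w \<in> space M"
  shows "(norm (block blk b (y i t w)))\<^sup>2 \<le> (\<Sum>j\<in>UNIV. W $ i $ j * (norm (u b j t w))\<^sup>2)"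
proof -
  have "0 \<le> (\<Sum>j\<in>UNIV. \<Sum>k\<in>UNIV. W $ i $ j * W $ i $ k * (norm (u b j t w - u b k t w))\<^sup>2) / 2"
    using W_doubly_stochastic unfolding doubly_stochastic_def
    by (intro divide_nonneg_nonneg sum_nonneg mult_nonneg_nonneg) auto
  then show ?thesis
    using weighted_norm_square_sum_diff[of "\<lambda>j. W $ i $ j" "\<lambda>j. u b j t w"] W_doubly_stochastic
    by (simp add: doubly_stochastic_def block_y[OF assms])
qed

text \<open>The bounded start gives the first second moment. Afterwards the square is dominated by
  those of the previous blocks and of the subgradient, all integrable by induction and
  \<open>subgradient_square_integrable\<close>.\<close>

lemma u_square_integrable: "integrable M (\<lambda>w. (norm (u b i t w))\<^sup>2)"
proof (induction t arbitrary: i)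
  case 0
  obtain R where R: "AE w in M. norm (x i 0 w) \<le> R" using x0_bounded by blast
  show ?case
  proof (rule integrable_const_bound)
    show "AE w in M. norm ((norm (u b i 0 w))\<^sup>2) \<le> R\<^sup>2"
      using R by eventually_elim (auto intro!: power_mono order_trans[OF norm_block_le])
  qed measurable
next
  case (Suc t)
  \<comment> \<open>The factors 2 come from \<open>norm_add_square_le\<close> with parameter 1; the
    bracket bounds both possible values of \<open>mixed\<close>.\<close>
  let ?B = "\<lambda>w. 2 * ((\<Sum>j\<in>UNIV. W $ i $ j * (norm (u b j t w))\<^sup>2) + (norm (u b i t w))\<^sup>2)
    + 2 * ((\<alpha> i t / \<sigma> b)\<^sup>2 * (norm (g i (y i t w) (\<xi> i t w)))\<^sup>2)"
  have W0: "0 \<le> (\<Sum>j\<in>UNIV. W $ i $ j * (norm (u b j t w))\<^sup>2)" for w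
    using W_doubly_stochastic by (auto intro!: sum_nonneg simp: doubly_stochastic_def)
  have int: "integrable M ?B"
    by (intro Bochner_Integration.integrable_add integrable_mult_right Bochner_Integration.integrable_sum
        Suc.IH subgradient_square_integrable)
  have bound: "(norm (u b i (Suc t) w))\<^sup>2 \<le> ?B w" if w: "w \<in> space M" for w
  proof -
    have "(norm (mixed b i t w))\<^sup>2 \<le> (\<Sum>j\<in>UNIV. W $ i $ j * (norm (u b j t w))\<^sup>2) + (norm (u b i t w))\<^sup>2"
      using block_y_norm_square_le[OF w, of b i t] W0[of w] by (auto simp: mixed_def add_increasing2)
    then show ?thesis
      using norm_add_square_le[of 1 "mixed b i t w" "u b i (Suc t) w - mixed b i t w"]
        u_Suc_mixed_dist[OF w, of b i t] by simp
  qed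
  show ?case
    by (rule Bochner_Integration.integrable_bound[OF int]) (use bound in \<open>auto intro!: AE_I2 order_trans[OF _ abs_ge_self]\<close>)
qed

text \<open>
  The matrix that acts on the blocks in expectation is not doubly stochastic, but its left
  eigenvector for the eigenvalue 1 has the entries \<open>1 / q i b\<close>.
\<close>

definition center :: "'b \<Rightarrow> nat \<Rightarrow> 'w \<Rightarrow> real ^ 'n" where
  "center b t w = weighted_mean (\<lambda>i. 1 / q i b) (\<lambda>i. u b i t w)"

definition disagreement :: "'b \<Rightarrow> nat \<Rightarrow> 'w \<Rightarrow> real" where
  "disagreement b t w = (\<Sum>i\<in>UNIV. 1 / q i b * (norm (u b i t w - center b t w))\<^sup>2)"

lemma center_measurable_past: "center b t \<in> borel_measurable (past t)"
proof -
  note [measurable] = x_measurable_past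
  show ?thesis unfolding center_def weighted_mean_def by measurable
qed

lemmas center_measurable [measurable] = center_measurable_past[THEN measurable_past_imp]

section \<open>Second moments of deviations from the center\<close>

lemma integrable_norm_square_diff:
  assumes "integrable M (\<lambda>w. (norm (f w))\<^sup>2)" "integrable M (\<lambda>w. (norm (h w))\<^sup>2)"
    and [measurable]: "f \<in> borel_measurable M" "h \<in> borel_measurable M"
  shows "integrable M (\<lambda>w. (norm (f w - h w :: 'c::euclidean_space))\<^sup>2)"
proof (rule Bochner_Integration.integrable_bound)
  show "integrable M (\<lambda>w. 2 * (norm (f w))\<^sup>2 + 2 * (norm (h w))\<^sup>2)"
    using assms(1,2) by simp
  show "AE w in M. norm ((norm (f w - h w))\<^sup>2) \<le> norm (2 * (norm (f w))\<^sup>2 + 2 * (norm (h w))\<^sup>2)"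
  proof (rule AE_I2)
    fix w
    show "norm ((norm (f w - h w))\<^sup>2) \<le> norm (2 * (norm (f w))\<^sup>2 + 2 * (norm (h w))\<^sup>2)"
      using norm_add_square_le[of 1 "f w" "- h w"] by simp
  qed
qed measurable

lemma integrable_norm_square_sum_scaleR:
  fixes f :: "'c::finite \<Rightarrow> 'w \<Rightarrow> 'd::euclidean_space"
  assumes "\<And>j. integrable M (\<lambda>w. (norm (f j w))\<^sup>2)" and [measurable]: "\<And>j. f j \<in> borel_measurable M"
  shows "integrable M (\<lambda>w. (norm (\<Sum>j\<in>UNIV. c j *\<^sub>R f j w))\<^sup>2)"
proof -
  have "integrable M (\<lambda>w. (norm (\<Sum>j\<in>J. c j *\<^sub>R f j w))\<^sup>2)" if "finite J" for J
    using that
  proof induction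
    case (insert j J)
    have "integrable M (\<lambda>w. (norm (c j *\<^sub>R f j w))\<^sup>2)"
      using assms(1)[of j] by (simp add: power_mult_distrib)
    \<comment> \<open>The new sum is read as the difference of the new term and the negated partial
      sum.\<close>
    from integrable_norm_square_diff[OF this insert.IH[folded norm_minus_cancel[of "\<Sum>j\<in>J. c j *\<^sub>R f j _"]]]
    show ?case using insert.hyps by simp
  qed simp
  then show ?thesis by simp
qed

lemma center_square_integrable: "integrable M (\<lambda>w. (norm (center b t w))\<^sup>2)"
proof -
  have "integrable M (\<lambda>w. (norm (\<Sum>i\<in>UNIV. (1 / q i b) *\<^sub>R u b i t w))\<^sup>2)"
    by (intro integrable_norm_square_sum_scaleR u_square_integrable) measurable
  then show ?thesis by (simp add: center_def weighted_mean_def power_mult_distrib power_divide)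
qed

lemma
  shows u_center_square_integrable: "integrable M (\<lambda>w. (norm (u b i t w - center b t w))\<^sup>2)"
    and y_center_square_integrable: "integrable M (\<lambda>w. (norm (block blk b (y i t w) - center b t w))\<^sup>2)"
proof -
  show "integrable M (\<lambda>w. (norm (u b i t w - center b t w))\<^sup>2)"
    by (intro integrable_norm_square_diff u_square_integrable center_square_integrable) measurable
  have "integrable M (\<lambda>w. (norm (\<Sum>j\<in>UNIV. W $ i $ j *\<^sub>R u b j t w))\<^sup>2)"
    by (intro integrable_norm_square_sum_scaleR u_square_integrable) measurable
  then have "integrable M (\<lambda>w. (norm (block blk b (y i t w)))\<^sup>2)"
    by (simp add: block_y cong: Bochner_Integration.integrable_cong)
  then show "integrable M (\<lambda>w. (norm (block blk b (y i t w) - center b t w))\<^sup>2)"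
    by (intro integrable_norm_square_diff center_square_integrable) measurable
qed

lemma disagreement_integrable: "integrable M (disagreement b t)"
  unfolding disagreement_def
  by (intro Bochner_Integration.integrable_sum integrable_mult_right u_center_square_integrable)

section \<open>Decrease of the disagreement\<close>

text \<open>The center minimizes the weighted squares. Hence the disagreement at time
  \<open>Suc t\<close> may be measured from the center of time \<open>t\<close>, which is known
  before the draws of iteration \<open>t\<close>.\<close>

lemma disagreement_le_center:
  "disagreement b t w \<le> (\<Sum>i\<in>UNIV. 1 / q i b * (norm (u b i t w - c))\<^sup>2)"
  unfolding disagreement_def center_def by (rule weighted_mean_minimizes) (simp add: q_pos)

lemma disagreement_le_pairwise:
  "disagreement b t w \<le> (\<Sum>i\<in>UNIV. 1 / q i b) * (\<Sum>i\<in>UNIV. \<Sum>j\<in>UNIV. (norm (u b i t w - u b j t w))\<^sup>2)"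
proof -
  \<comment> \<open>Any agent \<open>k\<close> can serve as the comparison center, since each
    squared distance to it is a term of the double sum.\<close>
  fix k :: 'i
  let ?D = "\<lambda>i. \<Sum>j\<in>UNIV. (norm (u b i t w - u b j t w))\<^sup>2"
  have "(norm (u b i t w - u b k t w))\<^sup>2 \<le> (\<Sum>i\<in>UNIV. ?D i)" for i
  proof -
    have "(norm (u b i t w - u b k t w))\<^sup>2 \<le> ?D i" by (intro member_le_sum) auto
    also have "\<dots> \<le> (\<Sum>i\<in>UNIV. ?D i)" by (rule member_le_sum) (auto intro: sum_nonneg)
    finally show ?thesis .
  qed
  then have "(\<Sum>i\<in>UNIV. 1 / q i b * (norm (u b i t w - u b k t w))\<^sup>2) \<le> (\<Sum>i\<in>UNIV. 1 / q i b * (\<Sum>i\<in>UNIV. ?D i))"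
    using q_pos by (intro sum_mono mult_left_mono) (auto intro: less_imp_le)
  then show ?thesis
    using disagreement_le_center[of b t w "u b k t w"] by (simp add: sum_distrib_right)
qed

text \<open>With the old center kept, Young's inequality separates the averaging from the proximal
  perturbation; \<epsilon> stays free to be matched to the contraction.\<close>

lemma disagreement_Suc_le:
  assumes "\<epsilon> > 0" and w: "w \<in> space M"
  shows "disagreement b (Suc t) w
    \<le> (1 + \<epsilon>) * (\<Sum>i\<in>UNIV. 1 / q i b * (norm (mixed b i t w - center b t w))\<^sup>2)
      + (1 + 1 / \<epsilon>) * (\<Sum>i\<in>UNIV. 1 / q i b * ((\<alpha> i t / \<sigma> b)\<^sup>2 * (norm (g i (y i t w) (\<xi> i t w)))\<^sup>2))"
proof -
  have "(norm (u b i (Suc t) w - center b t w))\<^sup>2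
      \<le> (1 + \<epsilon>) * (norm (mixed b i t w - center b t w))\<^sup>2
        + (1 + 1 / \<epsilon>) * ((\<alpha> i t / \<sigma> b)\<^sup>2 * (norm (g i (y i t w) (\<xi> i t w)))\<^sup>2)" for i
  proof -
    have "(1 + 1 / \<epsilon>) * (norm (u b i (Suc t) w - mixed b i t w))\<^sup>2
        \<le> (1 + 1 / \<epsilon>) * ((\<alpha> i t / \<sigma> b)\<^sup>2 * (norm (g i (y i t w) (\<xi> i t w)))\<^sup>2)"
      using assms by (intro mult_left_mono u_Suc_mixed_dist) auto
    then show ?thesis
      using norm_add_square_le[OF assms(1), of "mixed b i t w - center b t w" "u b i (Suc t) w - mixed b i t w"]
      by simp
  qed
  then have "(\<Sum>i\<in>UNIV. 1 / q i b * (norm (u b i (Suc t) w - center b t w))\<^sup>2)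
      \<le> (\<Sum>i\<in>UNIV. 1 / q i b * ((1 + \<epsilon>) * (norm (mixed b i t w - center b t w))\<^sup>2
        + (1 + 1 / \<epsilon>) * ((\<alpha> i t / \<sigma> b)\<^sup>2 * (norm (g i (y i t w) (\<xi> i t w)))\<^sup>2)))"
    using q_pos by (intro sum_mono mult_left_mono) (auto intro: less_imp_le)
  also have "\<dots> = (1 + \<epsilon>) * (\<Sum>i\<in>UNIV. 1 / q i b * (norm (mixed b i t w - center b t w))\<^sup>2)
      + (1 + 1 / \<epsilon>) * (\<Sum>i\<in>UNIV. 1 / q i b * ((\<alpha> i t / \<sigma> b)\<^sup>2 * (norm (g i (y i t w) (\<xi> i t w)))\<^sup>2))"
    unfolding sum_distrib_left sum.distrib[symmetric]
    by (intro sum.cong refl) (simp only: distrib_left mult.left_commute)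
  finally show ?thesis using disagreement_le_center[of b "Suc t" w "center b t w"] by linarith
qed

text \<open>Both candidate values of \<open>mixed\<close> and the center are determined by the past,
  while the update event is independent of it. Its probability therefore factors out of each
  expectation.\<close>

lemma
  shows mixed_square_integrable: "integrable M (\<lambda>w. (norm (mixed b i t w - center b t w))\<^sup>2)"
    and expectation_mixed_square: "expectation (\<lambda>w. (norm (mixed b i t w - center b t w))\<^sup>2)
      = q i b * expectation (\<lambda>w. (norm (block blk b (y i t w) - center b t w))\<^sup>2)
        + (1 - q i b) * expectation (\<lambda>w. (norm (u b i t w - center b t w))\<^sup>2)"
proof -
  note [measurable] = x_measurable_past y_measurable_past center_measurable_past
  let ?y = "\<lambda>w. (norm (block blk b (y i t w) - center b t w))\<^sup>2"
  let ?u = "\<lambda>w. (norm (u b i t w - center b t w))\<^sup>2"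
  let ?A = "\<lambda>w. of_bool (update b i t w) :: real"
  have A [measurable]: "?A \<in> borel_measurable M"
    using s_measurable l_measurable by measurable
  have eq: "(norm (mixed b i t w - center b t w))\<^sup>2 = ?A w * ?y w + (?u w - ?A w * ?u w)" for w
    by (simp add: mixed_def)
  have intA: "integrable M (\<lambda>w. ?A w * f w)" if "integrable M f" for f :: "'w \<Rightarrow> real"
    by (rule Bochner_Integration.integrable_bound[OF that]) (use that in auto)
  note ints = u_center_square_integrable[of b i t] y_center_square_integrable[of b i t]
  show "integrable M (\<lambda>w. (norm (mixed b i t w - center b t w))\<^sup>2)"
    unfolding eq using ints intA by (intro Bochner_Integration.integrable_add Bochner_Integration.integrable_diff) auto
  have "expectation (\<lambda>w. ?A w * ?y w) = q i b * expectation ?y"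
    by (rule expectation_update_mult[OF _ ints(2)]) measurable
  moreover have "expectation (\<lambda>w. ?A w * ?u w) = q i b * expectation ?u"
    by (rule expectation_update_mult[OF _ ints(1)]) measurable
  ultimately show "expectation (\<lambda>w. (norm (mixed b i t w - center b t w))\<^sup>2)
      = q i b * expectation ?y + (1 - q i b) * expectation ?u"
    unfolding eq using ints intA by (simp add: left_diff_distrib)
qed

text \<open>The weight \<open>1 / q i b\<close> cancels the update probability, so the expected
  change of the weighted sum is the sum of \<open>?y i\<close> minus \<open>?u i\<close> over the
  agents. This is minus the loss of squares under \<open>W\<close>, which the gap bounds by pairwise
  distances and hence by the disagreement.\<close>

lemma expectation_mixed_contraction:
  assumes gap: "\<And>v :: 'i \<Rightarrow> real ^ 'n. \<kappa> * (\<Sum>i\<in>UNIV. \<Sum>j\<in>UNIV. (norm (v i - v j))\<^sup>2)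
       \<le> (\<Sum>i\<in>UNIV. (norm (v i))\<^sup>2) - (\<Sum>i\<in>UNIV. (norm (\<Sum>j\<in>UNIV. W $ i $ j *\<^sub>R v j))\<^sup>2)"
    and "\<kappa> > 0"
  shows "expectation (\<lambda>w. \<Sum>i\<in>UNIV. 1 / q i b * (norm (mixed b i t w - center b t w))\<^sup>2)
    \<le> (1 - \<kappa> / (\<Sum>i\<in>UNIV. 1 / q i b)) * expectation (disagreement b t)"
proof -
  let ?P = "\<Sum>i\<in>UNIV. 1 / q i b"
  let ?y = "\<lambda>i w. (norm (block blk b (y i t w) - center b t w))\<^sup>2"
  let ?u = "\<lambda>i w. (norm (u b i t w - center b t w))\<^sup>2"
  have P: "?P > 0" using q_pos by (intro sum_pos) auto
  have le: "disagreement b t w + (\<Sum>i\<in>UNIV. ?y i w) - (\<Sum>i\<in>UNIV. ?u i w)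
      \<le> (1 - \<kappa> / ?P) * disagreement b t w" if w: "w \<in> space M" for w
  proof -
    \<comment> \<open>Rows sum to 1, so averaging commutes with subtracting the center; pairwise
      differences are unaffected by the shift.\<close>
    have "(\<Sum>j\<in>UNIV. W $ i $ j *\<^sub>R (u b j t w - center b t w)) = block blk b (y i t w) - center b t w" for i
      using W_doubly_stochastic
      by (simp add: block_y[OF w] scaleR_diff_right sum_subtractf doubly_stochastic_def flip: scaleR_sum_left)
    then have "\<kappa> * (\<Sum>i\<in>UNIV. \<Sum>j\<in>UNIV. (norm (u b i t w - u b j t w))\<^sup>2)
        \<le> (\<Sum>i\<in>UNIV. ?u i w) - (\<Sum>i\<in>UNIV. ?y i w)"
      using gap[of "\<lambda>i. u b i t w - center b t w"] by simp
    moreover have "\<kappa> / ?P * disagreement b t w \<le> \<kappa> / ?P * (?P * (\<Sum>i\<in>UNIV. \<Sum>j\<in>UNIV. (norm (u b i t w - u b j t w))\<^sup>2))"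
      using P \<open>\<kappa> > 0\<close> by (intro mult_left_mono disagreement_le_pairwise) auto
    ultimately show ?thesis using P by (simp add: left_diff_distrib)
  qed
  note ints = u_center_square_integrable y_center_square_integrable disagreement_integrable
  have "expectation (\<lambda>w. \<Sum>i\<in>UNIV. 1 / q i b * (norm (mixed b i t w - center b t w))\<^sup>2)
      = (\<Sum>i\<in>UNIV. 1 / q i b * (q i b * expectation (?y i) + (1 - q i b) * expectation (?u i)))"
    by (simp only: Bochner_Integration.integral_sum mixed_square_integrable integrable_mult_right
        integral_mult_right_zero expectation_mixed_square)
  also have "\<dots> = (\<Sum>i\<in>UNIV. 1 / q i b * expectation (?u i) + expectation (?y i) - expectation (?u i))"
    using q_pos[of _ b] by (intro sum.cong refl) (simp add: field_simps less_imp_neq[symmetric])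
  also have "\<dots> = expectation (\<lambda>w. disagreement b t w + (\<Sum>i\<in>UNIV. ?y i w) - (\<Sum>i\<in>UNIV. ?u i w))"
    using ints unfolding disagreement_def
    by (simp add: sum.distrib sum_subtractf)
  also have "\<dots> \<le> expectation (\<lambda>w. (1 - \<kappa> / ?P) * disagreement b t w)"
    by (intro integral_mono) (use ints le in auto)
  finally show ?thesis by simp
qed

lemma expectation_disagreement_tendsto_zero:
  assumes gap: "\<And>v :: 'i \<Rightarrow> real ^ 'n. \<kappa> * (\<Sum>i\<in>UNIV. \<Sum>j\<in>UNIV. (norm (v i - v j))\<^sup>2)
       \<le> (\<Sum>i\<in>UNIV. (norm (v i))\<^sup>2) - (\<Sum>i\<in>UNIV. (norm (\<Sum>j\<in>UNIV. W $ i $ j *\<^sub>R v j))\<^sup>2)"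
    and "\<kappa> > 0"
    and alpha: "\<And>i. summable (\<lambda>t. (\<alpha> i t)\<^sup>2)"
  shows "(\<lambda>t. expectation (disagreement b t)) \<longlonglongrightarrow> 0"
proof -
  \<comment> \<open>The relative decrease is also taken as the parameter in Young's inequality, so
    the combined factor is \<open>1 - \<epsilon>\<^sup>2\<close>, below 1 for every positive
    \<epsilon>.\<close>
  define \<epsilon> where "\<epsilon> = \<kappa> / (\<Sum>i\<in>UNIV. 1 / q i b)"
  have \<epsilon>: "\<epsilon> > 0" unfolding \<epsilon>_def using q_pos \<open>\<kappa> > 0\<close> by (intro divide_pos_pos sum_pos) auto
  \<comment> \<open>The expected proximal perturbation, with each second moment replaced by its
    bound; square summable stepsizes make it summable.\<close>
  define \<delta> where "\<delta> t = (1 + 1 / \<epsilon>) * (\<Sum>i\<in>UNIV. 1 / q i b * ((\<alpha> i t / \<sigma> b)\<^sup>2 * Gbar i))" for t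
  show ?thesis
  proof (rule contraction_tendsto_zero[where \<rho> = "(1 + \<epsilon>) * (1 - \<epsilon>)" and \<delta> = \<delta>])
    show "(1 + \<epsilon>) * (1 - \<epsilon>) < 1" using \<epsilon> by (simp add: algebra_simps)
    show "0 \<le> expectation (disagreement b t)" for t
      using q_pos unfolding disagreement_def
      by (intro integral_nonneg_AE AE_I2 sum_nonneg mult_nonneg_nonneg) (auto intro: less_imp_le)
    show "0 \<le> \<delta> t" for t
      unfolding \<delta>_def using \<epsilon> q_pos Gbar_nonneg
      by (intro mult_nonneg_nonneg sum_nonneg) (auto intro: less_imp_le)
    show "summable \<delta>"
      unfolding \<delta>_def power_divide
      by (intro summable_mult summable_sum summable_mult2 summable_divide alpha)
    show "expectation (disagreement b (Suc t)) \<le> (1 + \<epsilon>) * (1 - \<epsilon>) * expectation (disagreement b t) + \<delta> t" for t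
    proof -
      let ?m = "\<lambda>w. \<Sum>i\<in>UNIV. 1 / q i b * (norm (mixed b i t w - center b t w))\<^sup>2"
      let ?e = "\<lambda>w. \<Sum>i\<in>UNIV. 1 / q i b * ((\<alpha> i t / \<sigma> b)\<^sup>2 * (norm (g i (y i t w) (\<xi> i t w)))\<^sup>2)"
      have ints: "integrable M ?m" "integrable M ?e"
        by (intro Bochner_Integration.integrable_sum integrable_mult_right mixed_square_integrable subgradient_square_integrable)+
      have "expectation (disagreement b (Suc t)) \<le> expectation (\<lambda>w. (1 + \<epsilon>) * ?m w + (1 + 1 / \<epsilon>) * ?e w)"
        using ints by (intro integral_mono disagreement_integrable disagreement_Suc_le \<epsilon>) auto
      also have "\<dots> = (1 + \<epsilon>) * expectation ?m + (1 + 1 / \<epsilon>) * expectation ?e"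
        using ints by simp
      finally have step: "expectation (disagreement b (Suc t)) \<le> (1 + \<epsilon>) * expectation ?m + (1 + 1 / \<epsilon>) * expectation ?e" .
      have "expectation ?e
          = (\<Sum>i\<in>UNIV. 1 / q i b * ((\<alpha> i t / \<sigma> b)\<^sup>2 * expectation (\<lambda>w. (norm (g i (y i t w) (\<xi> i t w)))\<^sup>2)))"
        by (simp only: Bochner_Integration.integral_sum subgradient_square_integrable integrable_mult_right
            integral_mult_right_zero)
      also have "\<dots> \<le> (\<Sum>i\<in>UNIV. 1 / q i b * ((\<alpha> i t / \<sigma> b)\<^sup>2 * Gbar i))"
        using q_pos by (intro sum_mono mult_left_mono subgradient_square_le) (auto intro: less_imp_le)
      finally have "(1 + 1 / \<epsilon>) * expectation ?e \<le> \<delta> t"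
        unfolding \<delta>_def using \<epsilon> by (intro mult_left_mono) auto
      moreover have "expectation ?m \<le> (1 - \<epsilon>) * expectation (disagreement b t)"
        unfolding \<epsilon>_def by (rule expectation_mixed_contraction[OF gap \<open>\<kappa> > 0\<close>])
      then have "(1 + \<epsilon>) * expectation ?m \<le> (1 + \<epsilon>) * ((1 - \<epsilon>) * expectation (disagreement b t))"
        using \<epsilon> by (intro mult_left_mono) auto
      ultimately show ?thesis using step by (simp add: mult.assoc)
    qed
  qed
qed

section \<open>From disagreement to consensus error\<close>

text \<open>The error refers to the uniform mean, the disagreement to a weighted one. In each block
  the weighted center is subtracted from both the agent and the uniform mean, and the triangle
  inequality applies.\<close>

lemma norm_diff_average_le:
  "norm (x i t w - (1 / real CARD('i)) *\<^sub>R (\<Sum>j\<in>UNIV. x j t w))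
    \<le> (\<Sum>b\<in>UNIV. norm (u b i t w - center b t w)
        + (1 / real CARD('i)) * (\<Sum>j\<in>UNIV. norm (u b j t w - center b t w)))"
proof -
  let ?N = "real CARD('i)"
  let ?d = "x i t w - (1 / ?N) *\<^sub>R (\<Sum>j\<in>UNIV. x j t w)"
  have "norm ?d \<le> (\<Sum>b\<in>UNIV. norm (block blk b ?d))"
    using norm_sum[of "\<lambda>b. block blk b ?d" UNIV] by (simp add: sum_block)
  also have "\<dots> \<le> (\<Sum>b\<in>UNIV. norm (u b i t w - center b t w)
        + (1 / ?N) * (\<Sum>j\<in>UNIV. norm (u b j t w - center b t w)))"
  proof (rule sum_mono)
    fix b
    have "block blk b ?d = u b i t w - (1 / ?N) *\<^sub>R (\<Sum>j\<in>UNIV. u b j t w)"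
      by (simp add: linear_diff[OF linear_block] linear_scale[OF linear_block] linear_sum[OF linear_block])
    also have "\<dots> = (u b i t w - center b t w) - (1 / ?N) *\<^sub>R (\<Sum>j\<in>UNIV. u b j t w - center b t w)"
      by (simp add: sum_subtractf scaleR_diff_right sum_constant_scaleR del: sum_constant)
    finally have "norm (block blk b ?d) \<le> norm (u b i t w - center b t w)
        + norm ((1 / ?N) *\<^sub>R (\<Sum>j\<in>UNIV. u b j t w - center b t w))"
      by (metis norm_triangle_ineq4)
    also have "norm ((1 / ?N) *\<^sub>R (\<Sum>j\<in>UNIV. u b j t w - center b t w))
        \<le> (1 / ?N) * (\<Sum>j\<in>UNIV. norm (u b j t w - center b t w))"
      by (simp add: divide_right_mono norm_sum)
    finally show "norm (block blk b ?d) \<le> norm (u b i t w - center b t w)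
        + (1 / ?N) * (\<Sum>j\<in>UNIV. norm (u b j t w - center b t w))"
      by simp
  qed
  finally show ?thesis .
qed

text \<open>The deviation of one agent is a single term of the disagreement, and its first moment is
  at most the root of its second moment.\<close>

lemma
  shows u_center_integrable: "integrable M (\<lambda>w. norm (u b i t w - center b t w))"
    and u_center_expectation_le:
      "expectation (\<lambda>w. norm (u b i t w - center b t w)) \<le> sqrt (q i b * expectation (disagreement b t))"
proof -
  have meas: "(\<lambda>w. norm (u b i t w - center b t w)) \<in> borel_measurable M" by measurable
  note * = expectation_square_le[OF meas u_center_square_integrable]
  show "integrable M (\<lambda>w. norm (u b i t w - center b t w))" by (rule *(1))
  have "1 / q i b * (norm (u b i t w - center b t w))\<^sup>2 \<le> disagreement b t w" for w
    unfolding disagreement_def using q_pos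
    by (intro member_le_sum[where f = "\<lambda>i. 1 / q i b * (norm (u b i t w - center b t w))\<^sup>2"])
       (auto simp: less_imp_le)
  then have "(norm (u b i t w - center b t w))\<^sup>2 \<le> q i b * disagreement b t w" for w
    using q_pos[of i b] by (simp add: field_simps)
  then have "expectation (\<lambda>w. (norm (u b i t w - center b t w))\<^sup>2) \<le> expectation (\<lambda>w. q i b * disagreement b t w)"
    by (intro integral_mono u_center_square_integrable integrable_mult_right disagreement_integrable)
  then have "(expectation (\<lambda>w. norm (u b i t w - center b t w)))\<^sup>2 \<le> q i b * expectation (disagreement b t)"
    using *(2) by simp
  then show "expectation (\<lambda>w. norm (u b i t w - center b t w)) \<le> sqrt (q i b * expectation (disagreement b t))"
    by (rule real_le_rsqrt)
qed

text \<open>The error is dominated by a finite combination of deviations from the centers; their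
  expectations lie between 0 and a root that tends to 0.\<close>

lemma
  assumes gap: "\<And>v :: 'i \<Rightarrow> real ^ 'n. \<kappa> * (\<Sum>i\<in>UNIV. \<Sum>j\<in>UNIV. (norm (v i - v j))\<^sup>2)
       \<le> (\<Sum>i\<in>UNIV. (norm (v i))\<^sup>2) - (\<Sum>i\<in>UNIV. (norm (\<Sum>j\<in>UNIV. W $ i $ j *\<^sub>R v j))\<^sup>2)"
    and "\<kappa> > 0"
    and alpha: "\<And>i. summable (\<lambda>t. (\<alpha> i t)\<^sup>2)"
  defines "d \<equiv> \<lambda>i t w. norm (x i t w - (1 / real CARD('i)) *\<^sub>R (\<Sum>j\<in>UNIV. x j t w))"
  shows consensus_error_integrable: "integrable M (d i t)"
    and consensus_error_tendsto_zero: "(\<lambda>t. expectation (d i t)) \<longlonglongrightarrow> 0"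
proof -
  let ?N = "real CARD('i)"
  let ?r = "\<lambda>b i t w. norm (u b i t w - center b t w)"
  let ?B = "\<lambda>t w. \<Sum>b\<in>UNIV. ?r b i t w + (1 / ?N) * (\<Sum>j\<in>UNIV. ?r b j t w)"
  have B: "integrable M (?B t)" for t
    by (intro Bochner_Integration.integrable_sum Bochner_Integration.integrable_add integrable_mult_right u_center_integrable)
  have [measurable]: "d i t \<in> borel_measurable M" for t unfolding d_def by measurable
  have le: "d i t w \<le> ?B t w" for t w unfolding d_def by (rule norm_diff_average_le)
  have int: "integrable M (d i t)" for t
  proof (rule Bochner_Integration.integrable_bound[OF B _ AE_I2])
    show "norm (d i t w) \<le> norm (?B t w)" for w
      using order_trans[OF le abs_ge_self, of t w] by (simp add: d_def)
  qed measurable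
  then show "integrable M (d i t)" .
  have r: "(\<lambda>t. expectation (?r b j t)) \<longlonglongrightarrow> 0" for b j
  proof (rule tendsto_sandwich[OF _ _ tendsto_const])
    have "(\<lambda>t. sqrt (q j b * expectation (disagreement b t))) \<longlonglongrightarrow> sqrt (q j b * 0)"
      by (intro tendsto_intros expectation_disagreement_tendsto_zero[OF gap assms(2) alpha])
    then show "(\<lambda>t. sqrt (q j b * expectation (disagreement b t))) \<longlonglongrightarrow> 0" by simp
  qed (auto intro!: always_eventually u_center_expectation_le integral_nonneg_AE)
  let ?e = "\<lambda>t. \<Sum>b\<in>UNIV. expectation (?r b i t) + (1 / ?N) * (\<Sum>j\<in>UNIV. expectation (?r b j t))"
  have "?e \<longlonglongrightarrow> (\<Sum>b\<in>(UNIV::'b set). 0 + (1 / ?N) * (\<Sum>j\<in>(UNIV::'i set). 0))"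
    by (intro tendsto_intros r)
  then have lim: "?e \<longlonglongrightarrow> 0" by simp
  have "expectation (d i t) \<le> ?e t" for t
  proof -
    have "expectation (d i t) \<le> expectation (?B t)"
      by (intro integral_mono int B le)
    then show ?thesis by (simp add: u_center_integrable)
  qed
  moreover have "0 \<le> expectation (d i t)" for t by (simp add: d_def)
  ultimately show "(\<lambda>t. expectation (d i t)) \<longlonglongrightarrow> 0"
    by (intro tendsto_sandwich[OF _ _ tendsto_const lim] always_eventually allI)
qed

end

theorem lemma11:
  fixes M :: "'w measure"
    and D :: "'i::finite \<Rightarrow> 'z measure"
    and h :: "'i \<Rightarrow> real ^ 'n::finite \<Rightarrow> 'z \<Rightarrow> real"
    and g :: "'i \<Rightarrow> real ^ 'n \<Rightarrow> 'z \<Rightarrow> real ^ 'n"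
    and blk :: "'n \<Rightarrow> 'b::finite"
    and X :: "'b \<Rightarrow> (real ^ 'n) set"
    and \<omega> :: "'b \<Rightarrow> real ^ 'n \<Rightarrow> real"
    and d\<omega> :: "'b \<Rightarrow> real ^ 'n \<Rightarrow> real ^ 'n"
    and \<sigma> :: "'b \<Rightarrow> real"
    and E :: "('i \<times> 'i) set"
    and W :: "real ^ 'i ^ 'i"
    and \<eta> :: real
    and s :: "'i \<Rightarrow> nat \<Rightarrow> 'w \<Rightarrow> bool"
    and l :: "'i \<Rightarrow> nat \<Rightarrow> 'w \<Rightarrow> 'b"
    and \<xi> :: "'i \<Rightarrow> nat \<Rightarrow> 'w \<Rightarrow> 'z"
    and p_on :: "'i \<Rightarrow> real"
    and p :: "'i \<Rightarrow> 'b \<Rightarrow> real"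
    and \<alpha> :: "'i \<Rightarrow> nat \<Rightarrow> real"
    and x y :: "'i \<Rightarrow> nat \<Rightarrow> 'w \<Rightarrow> real ^ 'n"
    and xbar :: "nat \<Rightarrow> 'w \<Rightarrow> real ^ 'n"
    and G Gbar C :: "'i \<Rightarrow> real"
  assumes prob_M: "prob_space M"
    and prob_D: "\<And>i. prob_space (D i)"
    and h_continuous: "\<And>i z. z \<in> space (D i) \<Longrightarrow> continuous_on UNIV (\<lambda>u. h i u z)"
    and h_convex: "\<And>i z. z \<in> space (D i) \<Longrightarrow> convex_on UNIV (\<lambda>u. h i u z)"
    and h_integrable: "\<And>i u. integrable (D i) (h i u)"
    and g_subgradient: "\<And>i u z. z \<in> space (D i) \<Longrightarrow> g i u z \<in> subdifferential (\<lambda>v. h i v z) u"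
    and g_measurable: "\<And>i. (\<lambda>(u, z). g i u z) \<in> borel_measurable (borel \<Otimes>\<^sub>M D i)"
    and X_block: "\<And>b. X b \<subseteq> block_space blk b"
    and X_closed: "\<And>b. closed (X b)"
    and X_convex: "\<And>b. convex (X b)"
    and omega_C1: "\<And>b. C1_on (X b) (\<omega> b) (d\<omega> b)"
    and gradient_block: "\<And>b a. a \<in> X b \<Longrightarrow> d\<omega> b a \<in> block_space blk b"
    and sigma_pos: "\<And>b. \<sigma> b > 0"
    and omega_strongly_convex: "\<And>b. strongly_convex_on (\<sigma> b) (X b) (\<omega> b)"
    and graph_connected: "strongly_connected (graph_on E)"
    and W_doubly_stochastic: "doubly_stochastic W"
    and W_edges: "\<And>i j. i \<noteq> j \<Longrightarrow> W $ i $ j > 0 \<longleftrightarrow> (j, i) \<in> E"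
    and eta_pos: "\<eta> > 0"
    and W_diag: "\<And>i. W $ i $ i \<ge> \<eta>"
    and W_lower: "\<And>i j. W $ i $ j > 0 \<Longrightarrow> W $ i $ j \<ge> \<eta>"
    and p_on_range: "\<And>i. p_on i \<in> {0<..1}"
    and p_pos: "\<And>i b. p i b > 0"
    and s_measurable: "\<And>i t. s i t \<in> measurable M (count_space UNIV)"
    and l_measurable: "\<And>i t. l i t \<in> measurable M (count_space UNIV)"
    and xi_measurable: "\<And>i t. \<xi> i t \<in> measurable M (D i)"
    and x0_measurable: "\<And>i. x i 0 \<in> borel_measurable M"
    and s_prob: "\<And>i t. measure M {w \<in> space M. s i t w} = p_on i"
    and l_prob: "\<And>i t b. measure M {w \<in> space M. l i t w = b} = p i b"
    and xi_distr: "\<And>i t. distr M (D i) (\<xi> i t) = D i"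
    and s_indep: "\<And>i. prob_space.indep_vars M (\<lambda>_. count_space UNIV) (\<lambda>t. s i t) UNIV"
    and l_indep: "\<And>i. prob_space.indep_vars M (\<lambda>_. count_space UNIV) (\<lambda>t. l i t) UNIV"
    and indep_within: "\<And>t. prob_space.indep_sets M (draw_events M D s l \<xi> t) UNIV"
    and indep_past: "\<And>t. prob_space.indep_set M
           (generated_events M (iteration_space D) (iteration_draws s l \<xi> t))
           (generated_events M (history_space D t) (history (\<lambda>i. x i 0) s l \<xi> t))"
    and x0_feasible: "\<And>i w. w \<in> space M \<Longrightarrow> x i 0 w \<in> block_product blk X"
    and x0_bounded: "\<And>i. \<exists>R. AE w in M. norm (x i 0 w) \<le> R"
    and y_def: "\<And>i t w. w \<in> space M \<Longrightarrow> y i t w = (\<Sum>j\<in>UNIV. W $ i $ j *\<^sub>R x j t w)"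
    and x_awake: "\<And>i t w. w \<in> space M \<Longrightarrow> s i t w \<Longrightarrow>
           block blk (l i t w) (x i (Suc t) w) =
             prox (X (l i t w)) (\<omega> (l i t w)) (d\<omega> (l i t w))
               (block blk (l i t w) (y i t w))
               (block blk (l i t w) (g i (y i t w) (\<xi> i t w)))
               (\<alpha> i t)"
    and x_other_blocks: "\<And>i t w b. w \<in> space M \<Longrightarrow> s i t w \<Longrightarrow> b \<noteq> l i t w \<Longrightarrow>
           block blk b (x i (Suc t) w) = block blk b (x i t w)"
    and x_idle: "\<And>i t w. w \<in> space M \<Longrightarrow> \<not> s i t w \<Longrightarrow> x i (Suc t) w = x i t w"
    and xbar_def: "\<And>t w. w \<in> space M \<Longrightarrow> xbar t w = (1 / real CARD('i)) *\<^sub>R (\<Sum>i\<in>UNIV. x i t w)"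
    and alpha_pos: "\<And>i t. \<alpha> i t > 0"
    and alpha_not_summable: "\<And>i. filterlim (\<lambda>T. \<Sum>t<T. \<alpha> i t) at_top sequentially"
    and alpha_square_summable: "\<And>i. summable (\<lambda>t. (\<alpha> i t)\<^sup>2)"
    and alpha_decreasing: "\<And>i t. \<alpha> i (Suc t) \<le> \<alpha> i t"
    and G_nonneg: "\<And>i. G i \<ge> 0"
    and Gbar_nonneg: "\<And>i. Gbar i \<ge> 0"
    and g_norm_integrable: "\<And>i u. integrable (D i) (\<lambda>z. norm (g i u z))"
    and g_norm_bound: "\<And>i u. (\<integral>z. norm (g i u z) \<partial>D i) \<le> G i"
    and g_square_integrable: "\<And>i u. integrable (D i) (\<lambda>z. (norm (g i u z))\<^sup>2)"
    and g_square_bound: "\<And>i u. (\<integral>z. (norm (g i u z))\<^sup>2 \<partial>D i) \<le> Gbar i"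
    and C_nonneg: "\<And>i. C i \<ge> 0"
    and x0_integrable: "\<And>i. integrable M (\<lambda>w. norm (x i 0 w))"
    and x0_norm_bound: "\<And>i. (\<integral>w. norm (x i 0 w) \<partial>M) \<le> C i"
  shows "\<forall>i. (\<forall>t. integrable M (\<lambda>w. norm (x i t w - xbar t w))) \<and>
             (\<lambda>t. \<integral>w. norm (x i t w - xbar t w) \<partial>M) \<longlonglongrightarrow> 0"
proof -
  interpret prob_space M by (rule prob_M)
  have update_prob: "prob {w \<in> space M. s i t w \<and> l i t w = b} = p_on i * p i b" for i t b
  proof -
    \<comment> \<open>The awake flag and the block draw of one agent are two members of the
      independent family of iteration \<open>t\<close>. \<open>Sample\<close> falls under the
      default case and lies outside the index set used below.\<close>
    define A where "A d = (case d of Awake _ \<Rightarrow> {w \<in> space M. s i t w} | _ \<Rightarrow> {w \<in> space M. l i t w = b})"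
      for d :: "'i draw"
    have "{w \<in> space M. s i t w} = s i t -` {True} \<inter> space M"
      "{w \<in> space M. l i t w = b} = l i t -` {b} \<inter> space M" by auto
    then have "A (Awake i) \<in> draw_events M D s l \<xi> t (Awake i)" "A (Block i) \<in> draw_events M D s l \<xi> t (Block i)"
      by (simp_all add: A_def draw_events_def generated_events_def in_vimage_algebra)
    then have "prob (\<Inter>d\<in>{Awake i, Block i}. A d) = (\<Prod>d\<in>{Awake i, Block i}. prob (A d))"
      by (intro indep_setsD[OF indep_within]) auto
    moreover have "(\<Inter>d\<in>{Awake i, Block i}. A d) = {w \<in> space M. s i t w \<and> l i t w = b}"
      by (auto simp: A_def)
    ultimately show ?thesis by (simp add: A_def s_prob l_prob)
  qed
  have q_pos: "p_on i * p i b > 0" for i b using p_on_range[of i] p_pos[of i b] by simp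
  interpret block_proximal_run M D g blk X \<omega> d\<omega> \<sigma> W s l \<xi> "\<lambda>i b. p_on i * p i b" \<alpha> x y Gbar
    by unfold_locales (fact g_measurable X_closed X_convex omega_C1 sigma_pos omega_strongly_convex
        W_doubly_stochastic q_pos s_measurable l_measurable xi_measurable x0_measurable update_prob
        xi_distr indep_past x0_feasible x0_bounded y_def x_awake x_other_blocks x_idle alpha_pos
        g_square_integrable g_square_bound)+
  have edges: "W $ i $ j \<ge> \<eta>" if "i \<noteq> j" "(j, i) \<in> E" for i j
    using W_lower W_edges that by blast
  obtain \<kappa> where "\<kappa> > 0" and gap: "\<And>v :: 'i \<Rightarrow> real ^ 'n.
      \<kappa> * (\<Sum>i\<in>UNIV. \<Sum>j\<in>UNIV. (norm (v i - v j))\<^sup>2)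
       \<le> (\<Sum>i\<in>UNIV. (norm (v i))\<^sup>2) - (\<Sum>i\<in>UNIV. (norm (\<Sum>j\<in>UNIV. W $ i $ j *\<^sub>R v j))\<^sup>2)"
    using doubly_stochastic_spectral_gap[OF W_doubly_stochastic graph_connected edges W_diag eta_pos] by blast
  note consensus = consensus_error_integrable[OF gap \<open>\<kappa> > 0\<close> alpha_square_summable]
    consensus_error_tendsto_zero[OF gap \<open>\<kappa> > 0\<close> alpha_square_summable]
  \<comment> \<open>The equation for \<open>xbar\<close> is given on \<open>space M\<close>, which
    the congruence rules for integrals supply.\<close>
  have "integrable M (\<lambda>w. norm (x i t w - xbar t w))" for i t
    using consensus(1)[of i t] by (simp add: xbar_def cong: Bochner_Integration.integrable_cong)
  moreover have "(\<lambda>t. \<integral>w. norm (x i t w - xbar t w) \<partial>M) \<longlonglongrightarrow> 0" for i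
    using consensus(2)[of i] by (simp add: xbar_def cong: Bochner_Integration.integral_cong)
  ultimately show ?thesis by blast
qed

end
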